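(* Let $L$ be an even integral lattice of signature $(2,n)$ containing at least two (mutually orthogonal) integral hyperbolic planes, such that $\operatorname{rank}_2(L)\ge 6$ and $\operatorname{rank}_3(L)\ge 5$. Then any (not identically zero) cusp form for $\widetilde{\mathrm O}^+(L)$ or $\widetilde{\mathrm{SO}}^+(L)$ vanishes to integral order along any toroidal boundary divisor. In particular the order of vanishing of a cusp form along a boundary divisor is always at least $1$.
   Context: Lattices: an even integral lattice is a free $\mathbb Z$-module of finite rank with a non-degenerate symmetric bilinear form $(\cdot,\cdot)$ with values in $\mathbb Z$ and $(u,u)\in2\mathbb Z$. Signature $(2,n)$ means two positive and $n$ negative squares. The integral hyperbolic plane is $U=\mathbb Z e\oplus\mathbb Z f$ with $(e,e)=(f,f)=0$, $(e,f)=1$; containing two of them means $L\cong U\oplus U\oplus L_0$. For a prime $p$, $\operatorname{rank}_p(L)$ is the maximal rank of a sublattice $M\subseteq L$ with $\det(M)$ coprime to $p$. With $L^\vee$ the dual lattice and $D(L)=L^\vee/L$ carrying its $\mathbb Q/2\mathbb Z$-valued quadratic form, $\widetilde{\mathrm O}(L)=\ker(\mathrm O(L)\to\mathrm O(D(L)))$. The real spinor norm of a product of reflections $\sigma_{v_1}\cdots\sigma_{v_m}\in \mathrm O(L\otimes\mathbb R)$, $\sigma_v(x)=x-\frac{2(x,v)}{(v,v)}v$, is $\prod_i(-\frac{(v_i,v_i)}{2})(\mathbb R^\times)^2$; $\mathrm O^+(\cdot)$ denotes the subgroup of trivial real spinor norm, $\widetilde{\mathrm O}^+(L)=\widetilde{\mathrm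 O}(L)\cap\mathrm O^+(L)$, $\widetilde{\mathrm{SO}}^+(L)=\widetilde{\mathrm O}^+(L)\cap\mathrm{SO}(L)$. Let $\Gamma$ be one of these two groups. Domain: $\mathcal D_L$ is a connected component of $\{[Z]\in\mathbb P(L\otimes\mathbb C)\mid (Z,Z)=0,\ (Z,\bar Z)>0\}$ and $\mathcal D_L^\bullet\subset L\otimes\mathbb C$ is the affine cone over it. Rational boundary components (cusps) $F$ of $\mathcal D_L$ correspond to non-zero totally isotropic subspaces $E\subset L\otimes\mathbb Q$; $F$ has dimension $\dim E-1\in\{0,1\}$. $U(F)$ is the centre of the unipotent radical of the stabiliser of $E\otimes\mathbb R$ in $\mathrm O^+(L\otimes\mathbb R)$, a real vector group, and $U(F)_{\mathbb Z}=U(F)\cap\Gamma$, a lattice in it. Order of vanishing (toroidal): for $r\in U(F)_{\mathbb Z}$ write $r=\exp(N)$ with $N$ nilpotent. Toroidal boundary divisors over $F$ correspond to elements $r\neq 1$, primitive in $U(F)_{\mathbb Z}$, such that $\exp(zN)$ maps $\mathcal D_L^\bullet$ into itself whenever $\operatorname{Im}z\ge0$ (if $\dim F=1$, this is the unique suitably oriented generator of $U(F)_{\mathbb Z}\cong\mathbb Z$; if $\dim F=0$, it ranges over primitive vectors in the closed rational cone of $U(F)$). A modular form of weight $k\in\mathbb Z$ and character $\chi\colon\Gamma\to\mathbb C^\times$ (of finite order) is a holomorphic function $\psi$ on $\mathcal D_L^\bullet$ with $\psi(sZ)=s^{-k}\psi(Z)$ for $s\in\mathbb C^\times$, $\psi(gZ)=\chi(g)\psi(Z)$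 for $g\in\Gamma$, and holomorphic at the cusps. Given such $r$, let $a\in\mathbb Q$ with $\chi(r)=e^{2\pi i a}$; then there is an expansion $\psi(\exp(zN)Z)=\sum_{m\in a+\mathbb Z}c_m(Z)e^{2\pi i m z}$ for $\operatorname{Im} z\ge 0$, $Z\in\mathcal D_L^\bullet$. Holomorphic at the cusps means $c_m\equiv 0$ for $m<0$, for all $F$ and $r$. The order of vanishing of $\psi$ along the boundary divisor given by $r$ is the smallest $m$ with $c_m\not\equiv0$. A cusp form (with some character) is a modular form vanishing at all cusps, i.e. its order of vanishing along every toroidal boundary divisor is strictly positive. *)

theory Defs
  imports
    "Jordan_Normal_Form.Determinant"
    "HOL-Algebra.Coset"
    "HOL-Analysis.Analysis"
begin

no_notation Matrix.vec_index (infixl "$" 100)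
hide_const (open) Matrix.mat Determinant.det

text \<open>
  A lattice of rank \<open>CARD('n)\<close> is \<open>\<int>^'n\<close> together with the Gram matrix \<open>S\<close> of its form in
  the standard basis; every free \<open>\<int>\<close>-module of finite rank with a form is of this shape after
  a choice of basis. The scalar extension of \<open>L\<close> to \<open>K = \<rat>, \<real>, \<complex>\<close> is the type \<open>K^'n\<close>, and
  the same function \<open>bform S\<close> is the bilinear form on all of them.
\<close>

definition bform :: "int^'n^'n \<Rightarrow> 'a::comm_ring_1^'n \<Rightarrow> 'a^'n \<Rightarrow> 'a" where
  "bform S x y = (\<Sum>i\<in>UNIV. \<Sum>j\<in>UNIV. of_int (S $ i $ j) * x $ i * y $ j)"

definition map_vector :: "('a \<Rightarrow> 'b) \<Rightarrow> 'a^'n \<Rightarrow> 'b^'n" where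
  "map_vector f x = (\<chi> i. f (x $ i))"

definition even_lattice :: "int^'n^'n \<Rightarrow> bool" where
  "even_lattice S \<longleftrightarrow>
     (\<forall>x y :: int^'n. bform S x y = bform S y x) \<and>
     (\<forall>x :: int^'n. even (bform S x x)) \<and>
     (\<forall>x :: int^'n. (\<forall>y :: int^'n. bform S x y = 0) \<longrightarrow> x = 0)"

definition has_signature :: "int^'n^'n \<Rightarrow> nat \<Rightarrow> nat \<Rightarrow> bool" where
  "has_signature S p q \<longleftrightarrow>
     (\<exists>b :: 'n \<Rightarrow> real^'n. inj b \<and> independent (range b) \<and>
        (\<forall>i j. i \<noteq> j \<longrightarrow> bform S (b i) (b j) = 0) \<and>
        card {i. bform S (b i) (b i) > 0} = p \<and>
        card {i. bform S (b i) (b i) < 0} = q \<and>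
        CARD('n) = p + q)"

definition hyperbolic_pair :: "int^'n^'n \<Rightarrow> int^'n \<Rightarrow> int^'n \<Rightarrow> bool" where
  "hyperbolic_pair S e f \<longleftrightarrow> bform S e e = 0 \<and> bform S f f = 0 \<and> bform S e f = 1"

text \<open>\<open>L \<cong> U \<oplus> U \<oplus> L0\<close>, as an internal orthogonal decomposition.\<close>

definition contains_two_hyperbolic_planes :: "int^'n^'n \<Rightarrow> bool" where
  "contains_two_hyperbolic_planes S \<longleftrightarrow>
     (\<exists>e f e' f' (L0 :: (int^'n) set).
        hyperbolic_pair S e f \<and> hyperbolic_pair S e' f' \<and>
        (\<forall>u\<in>{e, f}. \<forall>v\<in>{e', f'}. bform S u v = 0) \<and>
        0 \<in> L0 \<and> (\<forall>x\<in>L0. \<forall>y\<in>L0. x - y \<in> L0) \<and>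
        (\<forall>u\<in>{e, f, e', f'}. \<forall>x\<in>L0. bform S u x = 0) \<and>
        (\<forall>x. \<exists>a b c d. \<exists>y\<in>L0. x = a *s e + b *s f + c *s e' + d *s f' + y))"

text \<open>
  A sublattice of rank \<open>r\<close> is given by a \<open>\<int>\<close>-basis \<open>vs\<close> of length \<open>r\<close>. The determinant is
  that of Jordan_Normal_Form, whose matrices have a size that is not a type.
\<close>

definition int_independent :: "(int^'n) list \<Rightarrow> bool" where
  "int_independent vs \<longleftrightarrow>
     (\<forall>c :: nat \<Rightarrow> int. (\<Sum>i<length vs. c i *s (vs ! i)) = 0 \<longrightarrow> (\<forall>i<length vs. c i = 0))"

definition gram_det :: "int^'n^'n \<Rightarrow> (int^'n) list \<Rightarrow> int" where
  "gram_det S vs = Determinant.det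
     (Matrix.mat (length vs) (length vs) (\<lambda>(i, j). bform S (vs ! i) (vs ! j)))"

definition rank_mod :: "nat \<Rightarrow> int^'n^'n \<Rightarrow> nat" where
  "rank_mod p S = Max {length vs | vs. int_independent vs \<and> coprime (gram_det S vs) (int p)}"


definition mat_group :: "('a::semiring_1^'n^'n) set \<Rightarrow> ('a^'n^'n) monoid" where
  "mat_group G = \<lparr>carrier = G, mult = (**), one = mat 1\<rparr>"

definition orthogonal_group :: "int^'n^'n \<Rightarrow> ('a::comm_ring_1^'n^'n) set" where
  "orthogonal_group S = {g. invertible g \<and> (\<forall>x y. bform S (g *v x) (g *v y) = bform S x y)}"

definition reflection :: "int^'n^'n \<Rightarrow> real^'n \<Rightarrow> real^'n \<Rightarrow> real^'n" where
  "reflection S v x = x - (2 * bform S x v / bform S v v) *s v"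

text \<open>
  \<open>c\<close> represents the class of the real spinor norm of \<open>g\<close> in \<open>\<real>\<^sup>\<times> / (\<real>\<^sup>\<times>)\<^sup>2\<close>; note the sign in
  \<open>- (v, v) / 2\<close>.
\<close>

definition has_spinor_norm :: "int^'n^'n \<Rightarrow> real^'n^'n \<Rightarrow> real \<Rightarrow> bool" where
  "has_spinor_norm S g c \<longleftrightarrow>
     (\<exists>vs. (\<forall>v\<in>set vs. bform S v v \<noteq> 0) \<and>
           (*v) g = foldr (\<lambda>v h. reflection S v \<circ> h) vs id \<and>
           (\<exists>t. t \<noteq> 0 \<and> c = (\<Prod>v\<leftarrow>vs. - (bform S v v / 2)) * t\<^sup>2))"

definition O_plus_real :: "int^'n^'n \<Rightarrow> (real^'n^'n) set" where
  "O_plus_real S = {g \<in> orthogonal_group S. has_spinor_norm S g 1}"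

definition dual_lattice :: "int^'n^'n \<Rightarrow> (rat^'n) set" where
  "dual_lattice S = {x. \<forall>l :: int^'n. bform S x (map_vector of_int l) \<in> \<int>}"

definition discriminant_group :: "int^'n^'n \<Rightarrow> (rat^'n) set set" where
  "discriminant_group S =
     (\<lambda>x. {x + map_vector of_int l | l :: int^'n. True}) ` dual_lattice S"

definition O_tilde :: "int^'n^'n \<Rightarrow> (int^'n^'n) set" where
  "O_tilde S = {g \<in> orthogonal_group S.
     \<forall>A\<in>discriminant_group S. (*v) (map_matrix of_int g) ` A = A}"

definition O_tilde_plus :: "int^'n^'n \<Rightarrow> (int^'n^'n) set" where
  "O_tilde_plus S = {g \<in> O_tilde S. map_matrix of_int g \<in> O_plus_real S}"

definition SO_tilde_plus :: "int^'n^'n \<Rightarrow> (int^'n^'n) set" where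
  "SO_tilde_plus S = {g \<in> O_tilde_plus S. det g = 1}"


definition proj_point :: "complex^'n \<Rightarrow> (complex^'n) set" where
  "proj_point Z = {c *s Z | c. c \<noteq> 0}"

text \<open>
  Points of projective space are lines without the origin, so the preimage in the vector space
  of a set \<open>W\<close> of points is \<open>\<Union>W\<close>, and the topology is the quotient topology.
\<close>

definition proj_topology :: "(complex^'n) set topology" where
  "proj_topology = topology (\<lambda>W. W \<subseteq> proj_point ` (- {0}) \<and> open (\<Union>W))"

lemma proj_point_eq:
  assumes "z \<in> proj_point x" "z \<in> proj_point y"
  shows "proj_point x = proj_point y"
proof -
  have sub: "proj_point (c *s x) \<subseteq> proj_point x" if "c \<noteq> 0" for c and x :: "complex^'n"
  proof
    fix w assume "w \<in> proj_point (c *s x)"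
    then obtain d where "d \<noteq> 0" "w = (d * c) *s x"
      by (auto simp: proj_point_def vector_smult_assoc)
    with that show "w \<in> proj_point x"
      unfolding proj_point_def by (intro CollectI exI[of _ "d * c"]) simp
  qed
  have eq: "proj_point z = proj_point x" if z: "z \<in> proj_point x" for x
  proof -
    obtain c where c: "c \<noteq> 0" "z = c *s x"
      using z by (auto simp: proj_point_def)
    then have "x = inverse c *s z"
      by (simp add: vector_smult_assoc)
    then show ?thesis
      using sub[OF c(1), of x] sub[of "inverse c" z] c by simp
  qed
  show ?thesis using eq[OF assms(1)] eq[OF assms(2)] by simp
qed

lemma openin_proj_topology:
  fixes W :: "(complex^'n) set set"
  shows "openin proj_topology W \<longleftrightarrow> W \<subseteq> proj_point ` (- {0}) \<and> open (\<Union>W)"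
proof -
  let ?P = "\<lambda>W. W \<subseteq> proj_point ` (- {0 :: complex^'n}) \<and> open (\<Union>W)"
  have Int: "?P (V \<inter> W)" if VW: "?P V" "?P W" for V W
  proof -
    have "A = B" if AB: "A \<in> V" "B \<in> W" "z \<in> A" "z \<in> B" for A B z
    proof -
      obtain x y where "A = proj_point x" "B = proj_point y"
        using AB(1,2) VW by (meson imageE subsetD)
      then show ?thesis using AB(3,4) proj_point_eq by metis
    qed
    then have "\<Union>(V \<inter> W) = \<Union>V \<inter> \<Union>W" by fast
    then show ?thesis using VW by auto
  qed
  have Un: "?P (\<Union>\<K>)" if "\<forall>K\<in>\<K>. ?P K" for \<K> :: "(complex^'n) set set set"
  proof -
    have "\<Union>(\<Union>\<K>) = (\<Union>K\<in>\<K>. \<Union>K)" by fast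
    moreover have "open (\<Union>K\<in>\<K>. \<Union>K)" using that by (intro open_UN) simp
    ultimately show ?thesis using that by (simp add: Sup_le_iff)
  qed
  have "istopology ?P"
    unfolding istopology_def using Int Un by simp
  then show ?thesis
    unfolding proj_topology_def by (subst topology_inverse') simp_all
qed

text \<open>The pairing of \<open>Z\<close> with its complex conjugate is real; \<open>Re\<close> only changes the type.\<close>

definition period_set :: "int^'n^'n \<Rightarrow> (complex^'n) set set" where
  "period_set S = proj_point ` {Z. Z \<noteq> 0 \<and> bform S Z Z = 0 \<and> Re (bform S Z (map_vector cnj Z)) > 0}"

definition is_domain :: "int^'n^'n \<Rightarrow> (complex^'n) set set \<Rightarrow> bool" where
  "is_domain S \<D> \<longleftrightarrow> \<D> \<in> connected_components_of (subtopology proj_topology (period_set S))"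

definition affine_cone :: "(complex^'n) set set \<Rightarrow> (complex^'n) set" where
  "affine_cone \<D> = {Z. Z \<noteq> 0 \<and> proj_point Z \<in> \<D>}"


definition isotropic_subspace :: "int^'n^'n \<Rightarrow> (rat^'n) set \<Rightarrow> bool" where
  "isotropic_subspace S E \<longleftrightarrow> vec.subspace E \<and> E \<noteq> {0} \<and> (\<forall>x\<in>E. \<forall>y\<in>E. bform S x y = 0)"

definition cusp_stabiliser :: "int^'n^'n \<Rightarrow> (rat^'n) set \<Rightarrow> (real^'n^'n) set" where
  "cusp_stabiliser S E =
     {g \<in> O_plus_real S. (*v) g ` span (map_vector of_rat ` E) = span (map_vector of_rat ` E)}"

definition mat_power :: "'a::semiring_1^'n^'n \<Rightarrow> nat \<Rightarrow> 'a^'n^'n" where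
  "mat_power A k = (((**) A) ^^ k) (mat 1)"

definition nilpotent_mat :: "'a::semiring_1^'n^'n \<Rightarrow> bool" where
  "nilpotent_mat A \<longleftrightarrow> (\<exists>k. mat_power A k = 0)"

definition mat_exp :: "'a::real_normed_field^'n^'n \<Rightarrow> 'a^'n^'n" where
  "mat_exp A = (\<Sum>k. (1 / fact k) *\<^sub>R mat_power A k)"

text \<open>
  The largest closed connected normal subgroup that consists of unipotent elements. For the
  groups considered here it is the group of real points of the algebraic unipotent radical.
\<close>

definition unipotent_radical :: "(real^'n^'n) set \<Rightarrow> (real^'n^'n) set" where
  "unipotent_radical G =
     \<Union>{H. H \<lhd> mat_group G \<and> closedin (top_of_set G) H \<and> connected H \<and>
          (\<forall>h\<in>H. nilpotent_mat (h - mat 1))}"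

definition centre :: "(real^'n^'n) set \<Rightarrow> (real^'n^'n) set" where
  "centre G = {u \<in> G. \<forall>g\<in>G. u ** g = g ** u}"

definition cusp_centre :: "int^'n^'n \<Rightarrow> (rat^'n) set \<Rightarrow> (real^'n^'n) set" where
  "cusp_centre S E = centre (unipotent_radical (cusp_stabiliser S E))"

definition cusp_centre_int ::
  "int^'n^'n \<Rightarrow> (int^'n^'n) set \<Rightarrow> (rat^'n) set \<Rightarrow> (int^'n^'n) set" where
  "cusp_centre_int S \<Gamma> E = {r \<in> \<Gamma>. map_matrix of_int r \<in> cusp_centre S E}"

definition exp_scaled :: "complex \<Rightarrow> real^'n^'n \<Rightarrow> complex^'n^'n" where
  "exp_scaled z N = mat_exp (map_matrix (\<lambda>x. z * of_real x) N)"

text \<open>\<open>r = exp(N)\<close> determines the nilpotent \<open>N\<close>, which is carried along as an argument.\<close>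

definition boundary_divisor ::
  "int^'n^'n \<Rightarrow> (int^'n^'n) set \<Rightarrow> (complex^'n) set set \<Rightarrow> (rat^'n) set \<Rightarrow>
     int^'n^'n \<Rightarrow> real^'n^'n \<Rightarrow> bool" where
  "boundary_divisor S \<Gamma> \<D> E r N \<longleftrightarrow>
     isotropic_subspace S E \<and>
     r \<in> cusp_centre_int S \<Gamma> E \<and> r \<noteq> mat 1 \<and>
     (\<forall>s\<in>cusp_centre_int S \<Gamma> E. \<forall>k. r = mat_power s k \<longrightarrow> k = 1) \<and>
     nilpotent_mat N \<and> map_matrix of_int r = mat_exp N \<and>
     (\<forall>z. Im z \<ge> 0 \<longrightarrow> (\<forall>Z\<in>affine_cone \<D>. exp_scaled z N *v Z \<in> affine_cone \<D>))"


definition complex_differentiable_at :: "(complex^'n \<Rightarrow> complex) \<Rightarrow> complex^'n \<Rightarrow> bool" where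
  "complex_differentiable_at f Z \<longleftrightarrow>
     (\<exists>f'. (f has_derivative f') (at Z) \<and> (\<forall>c v. f' (c *s v) = c * f' v))"

text \<open>
  The affine cone is not open in \<open>\<complex>^'n\<close> but a locally closed complex submanifold (an open part of
  the smooth locus of a quadric), and a function on it is holomorphic iff it extends locally to a
  holomorphic function on an open set of the ambient space.
\<close>

definition holomorphic_on_submanifold ::
  "(complex^'n \<Rightarrow> complex) \<Rightarrow> (complex^'n) set \<Rightarrow> bool" where
  "holomorphic_on_submanifold f M \<longleftrightarrow>
     (\<forall>Z\<in>M. \<exists>W F. open W \<and> Z \<in> W \<and> (\<forall>X\<in>W. complex_differentiable_at F X) \<and>
                  (\<forall>X\<in>W \<inter> M. F X = f X))"

definition finite_order_character :: "(int^'n^'n) set \<Rightarrow> (int^'n^'n \<Rightarrow> complex) \<Rightarrow> bool" where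
  "finite_order_character \<Gamma> \<xi> \<longleftrightarrow>
     \<xi> \<in> hom (mat_group \<Gamma>) \<lparr>carrier = - {0}, mult = (*), one = 1\<rparr> \<and>
     (\<exists>d>0. \<forall>g\<in>\<Gamma>. \<xi> g ^ d = 1)"

definition exponents :: "real \<Rightarrow> real set" where
  "exponents a = {a + of_int j | j. True}"

text \<open>
  \<open>\<psi>(exp(zN) Z) = \<Sum>\<^bsub>m \<in> a + \<int>\<^esub> c m Z \<cdot> e\<^bsup>2\<pi>imz\<^esup>\<close>, where \<open>a\<close> is a rational number with
  \<open>\<xi>(r) = e\<^bsup>2\<pi>ia\<^esup>\<close>; such an expansion is unique, and only the coefficients \<open>c m\<close> with
  \<open>m \<in> a + \<int>\<close> play a role.
\<close>

definition toroidal_expansion ::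
  "(complex^'n) set set \<Rightarrow> (int^'n^'n \<Rightarrow> complex) \<Rightarrow> (complex^'n \<Rightarrow> complex) \<Rightarrow>
     int^'n^'n \<Rightarrow> real^'n^'n \<Rightarrow> real \<Rightarrow> (real \<Rightarrow> complex^'n \<Rightarrow> complex) \<Rightarrow> bool" where
  "toroidal_expansion \<D> \<xi> \<psi> r N a c \<longleftrightarrow>
     a \<in> \<rat> \<and> \<xi> r = exp (2 * of_real pi * \<i> * of_real a) \<and>
     (\<forall>Z\<in>affine_cone \<D>. \<forall>z. Im z \<ge> 0 \<longrightarrow>
        ((\<lambda>m. c m Z * exp (2 * of_real pi * \<i> * of_real m * z)) has_sum
           \<psi> (exp_scaled z N *v Z)) (exponents a))"

definition modular_form ::
  "int^'n^'n \<Rightarrow> (int^'n^'n) set \<Rightarrow> (complex^'n) set set \<Rightarrow> int \<Rightarrow> (int^'n^'n \<Rightarrow> complex) \<Rightarrow>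
     (complex^'n \<Rightarrow> complex) \<Rightarrow> bool" where
  "modular_form S \<Gamma> \<D> k \<xi> \<psi> \<longleftrightarrow>
     finite_order_character \<Gamma> \<xi> \<and>
     holomorphic_on_submanifold \<psi> (affine_cone \<D>) \<and>
     (\<forall>s Z. s \<noteq> 0 \<longrightarrow> Z \<in> affine_cone \<D> \<longrightarrow> \<psi> (s *s Z) = s powi (- k) * \<psi> Z) \<and>
     (\<forall>g\<in>\<Gamma>. \<forall>Z\<in>affine_cone \<D>. \<psi> (map_matrix of_int g *v Z) = \<xi> g * \<psi> Z) \<and>
     (\<forall>E r N. boundary_divisor S \<Gamma> \<D> E r N \<longrightarrow>
        (\<exists>a c. toroidal_expansion \<D> \<xi> \<psi> r N a c \<and>
           (\<forall>m\<in>exponents a. m < 0 \<longrightarrow> (\<forall>Z\<in>affine_cone \<D>. c m Z = 0))))"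

text \<open>
  The order of vanishing as a relation: a function that vanishes identically has no order (its
  order would be \<open>\<infinity>\<close>), any other modular form has exactly one.
\<close>

definition vanishing_order ::
  "(complex^'n) set set \<Rightarrow> (int^'n^'n \<Rightarrow> complex) \<Rightarrow> (complex^'n \<Rightarrow> complex) \<Rightarrow>
     int^'n^'n \<Rightarrow> real^'n^'n \<Rightarrow> real \<Rightarrow> bool" where
  "vanishing_order \<D> \<xi> \<psi> r N m \<longleftrightarrow>
     (\<exists>a c. toroidal_expansion \<D> \<xi> \<psi> r N a c \<and>
        m \<in> exponents a \<and> (\<exists>Z\<in>affine_cone \<D>. c m Z \<noteq> 0) \<and>
        (\<forall>m'\<in>exponents a. m' < m \<longrightarrow> (\<forall>Z\<in>affine_cone \<D>. c m' Z = 0)))"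

definition cusp_form ::
  "int^'n^'n \<Rightarrow> (int^'n^'n) set \<Rightarrow> (complex^'n) set set \<Rightarrow> int \<Rightarrow> (int^'n^'n \<Rightarrow> complex) \<Rightarrow>
     (complex^'n \<Rightarrow> complex) \<Rightarrow> bool" where
  "cusp_form S \<Gamma> \<D> k \<xi> \<psi> \<longleftrightarrow>
     modular_form S \<Gamma> \<D> k \<xi> \<psi> \<and>
     (\<forall>E r N m. boundary_divisor S \<Gamma> \<D> E r N \<longrightarrow> vanishing_order \<D> \<xi> \<psi> r N m \<longrightarrow> m > 0)"

end

(*
  Only the fact that the boundary element r = exp(N) lies in the discriminant kernel and that
  exp(zN) preserves the cone is needed. This positivity restricts the logarithm N severely, because
  the signature is (2, n): three pairwise orthogonal vectors of non-negative norm are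
  dependent, which forces N^3 = 0 and N = e wedge b for an isotropic vector e. As r acts trivially on
  the discriminant group, e and b can be chosen in the lattice, so r is an Eichler transvection
  t(e, a): x |-> x - (a, x) e + (e, x) a - (a, a)/2 (e, x) e.

  A character is trivial on all transvections t(v, a). If v is orthogonal to a hyperbolic plane with
  basis e, f, conjugating t(v, e) by t(f, a) shows that t(v, a) contributes a power of the value at
  t(v, f). For vectors of two orthogonal planes this value x satisfies x^12 = 1, because of the
  relations in SL_2(Z), and x^(b, c) = 1 for all b, c in the complement; the rank conditions at
  2 and 3 give x = 1. A Euclidean algorithm moves an arbitrary isotropic v into the complement of a
  hyperbolic plane. Hence the expansion runs over integral exponents.
*)
theory Submission
  imports Defs
begin

section \<open>The bilinear form\<close>

text \<open>The logarithm N is only a real nilpotent matrix, so two things have to be recovered.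
  Antisymmetry of N comes from exp(N) being an isometry. Integrality comes from r: depending on
  whether N^2 vanishes, r - 1 or (r - 1)^2 is an integral matrix equal to N or N^2, and its image
  contains an integral vector on the line of e. The vector a arises as r w - w for a w in the dual
  lattice with (e, w) = 1. Such a w need not lie in L, which is why triviality on the discriminant
  group is the right condition.

  The exponents (b, c) come from a clash: a |-> xi(t(e, a)) is a homomorphism, but on the complement
  of both planes it is x to the power (a, a)/2, a quadratic function of a. Polarising gives x^(b, c)
  = 1. Since 12 = 4 * 3, values (b, c) prime to 2 and to 3 are what is needed.

  Conjugations are only by products of transvections, which lie in the special group; this treats
  both choices of the group at once.\<close>

lemma bform_add_left: "bform S (x + y) z = bform S x z + bform S y z"
  by (simp add: bform_def algebra_simps sum.distrib)

lemma bform_add_right: "bform S x (y + z) = bform S x y + bform S x z"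
  by (simp add: bform_def algebra_simps sum.distrib)

lemma bform_diff_left: "bform S (x - y) z = bform S x z - bform S y z"
  by (simp add: bform_def algebra_simps sum_subtractf)

lemma bform_diff_right: "bform S x (y - z) = bform S x y - bform S x z"
  by (simp add: bform_def algebra_simps sum_subtractf)

lemma bform_scale_left: "bform S (c *s x) y = c * bform S x y"
  by (simp add: bform_def sum_distrib_left algebra_simps)

lemma bform_scale_right: "bform S x (c *s y) = c * bform S x y"
  by (simp add: bform_def sum_distrib_left algebra_simps)

lemma bform_zero_left [simp]: "bform S 0 y = 0"
  by (simp add: bform_def)

lemma bform_zero_right [simp]: "bform S x 0 = 0"
  by (simp add: bform_def)

lemma bform_minus_left: "bform S (- x) y = - bform S x y"
  by (simp add: bform_def sum_negf)

lemma bform_minus_right: "bform S x (- y) = - bform S x y"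
  by (simp add: bform_def sum_negf)

lemmas bform_simps = bform_add_left bform_add_right bform_diff_left bform_diff_right
  bform_scale_left bform_scale_right bform_minus_left bform_minus_right

lemma bform_sum_left: "bform S (\<Sum>i\<in>A. f i) y = (\<Sum>i\<in>A. bform S (f i) y)"
  by (induction A rule: infinite_finite_induct) (simp_all add: bform_simps)

lemma bform_sum_right: "bform S x (\<Sum>i\<in>A. f i) = (\<Sum>i\<in>A. bform S x (f i))"
  by (induction A rule: infinite_finite_induct) (simp_all add: bform_simps)

lemma vec_eq_sum_axis: "(x :: 'a::comm_ring_1^'n) = (\<Sum>i\<in>UNIV. x $ i *s axis i 1)"
proof (subst vec_eq_iff, intro allI)
  fix k
  have "(\<Sum>i\<in>UNIV. x $ i * (if k = i then 1 else 0)) = (\<Sum>i\<in>UNIV. if k = i then x $ i else 0)"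
    by (intro sum.cong) auto
  then show "x $ k = (\<Sum>i\<in>UNIV. x $ i *s axis i 1) $ k"
    by (simp add: axis_def)
qed

lemma bform_axis: "bform S (axis i 1) (axis j 1) = of_int (S $ i $ j)"
proof -
  have "bform S (axis i 1) (axis j 1) =
      (\<Sum>k\<in>UNIV. \<Sum>l\<in>UNIV. if l = j then (if k = i then of_int (S $ k $ l) else 0) else 0)"
    unfolding bform_def by (intro sum.cong) (auto simp: axis_def)
  then show ?thesis by simp
qed

lemma bform_expand_right:
  "bform S x y = (\<Sum>j\<in>UNIV. bform S x (axis j 1) * y $ j)"
  by (subst vec_eq_sum_axis[of y]) (simp add: bform_sum_right bform_simps mult.commute)

lemma map_vector_nth [simp]: "map_vector f x $ i = f (x $ i)"
  by (simp add: map_vector_def)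

lemma bform_of_int:
  "bform S (map_vector of_int x) (map_vector of_int y) = of_int (bform S x y)"
  by (simp add: bform_def)

lemma bform_of_real:
  "bform S (map_vector of_real x) (map_vector of_real y) = of_real (bform S x y)"
  by (simp add: bform_def)

lemma bform_of_rat:
  "bform S (map_vector of_rat x) (map_vector of_rat y) = (of_rat (bform S x y) :: 'a::field_char_0)"
  by (simp add: bform_def of_rat_sum of_rat_mult)

lemma map_vector_of_int_add:
  "map_vector of_int (x + y) = map_vector of_int x + map_vector of_int y"
  by (simp add: vec_eq_iff)

lemma map_vector_of_int_scale:
  "map_vector of_int (c *s x) = of_int c *s map_vector of_int x"
  by (simp add: vec_eq_iff)

lemma map_matrix_nth [simp]: "map_matrix f A $ i $ j = f (A $ i $ j)"
  by (simp add: map_matrix_def)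

lemma of_int_matrix_vector_mult:
  "map_matrix of_int A *v map_vector of_int x = map_vector of_int (A *v x)"
  by (simp add: vec_eq_iff matrix_vector_mult_def)

lemma of_rat_matrix_vector_mult:
  "map_matrix of_int A *v map_vector (of_rat :: rat \<Rightarrow> 'a::field_char_0) x =
   map_vector of_rat (map_matrix of_int A *v x)"
  by (simp add: vec_eq_iff matrix_vector_mult_def of_rat_sum of_rat_mult)

lemma of_int_matrix_mult:
  "map_matrix of_int (A ** B) = map_matrix of_int A ** map_matrix of_int B"
  by (simp add: vec_eq_iff matrix_matrix_mult_def)

lemma of_int_mat_1 [simp]: "map_matrix of_int (mat 1) = mat 1"
  by (simp add: vec_eq_iff mat_def)

lemma of_int_matrix_eq_iff:
  "map_matrix (of_int :: int \<Rightarrow> 'a::ring_char_0) A = map_matrix of_int B \<longleftrightarrow> A = B"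
  by (simp add: vec_eq_iff)

lemma det_of_int: "det (map_matrix of_int A) = of_int (det A)"
  by (simp add: det_def of_int_sum of_int_prod)

text \<open>Testing on basis vectors shows that the Gram matrix is symmetric, and this carries over
  to every coefficient ring.\<close>

lemma bform_commute_gen:
  assumes "\<And>x y :: int^'n. bform S x y = bform S y x"
  shows "bform S (x :: 'a::comm_ring_1^'n) y = bform S y x"
proof -
  have "S $ i $ j = S $ j $ i" for i j
    using assms[of "axis i 1" "axis j 1"] by (simp add: bform_axis)
  then have "bform S x y = (\<Sum>i\<in>UNIV. \<Sum>j\<in>UNIV. of_int (S $ j $ i) * x $ i * y $ j)"
    by (simp add: bform_def)
  also have "\<dots> = (\<Sum>j\<in>UNIV. \<Sum>i\<in>UNIV. of_int (S $ j $ i) * x $ i * y $ j)"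
    by (rule sum.swap)
  also have "\<dots> = bform S y x"
    unfolding bform_def by (intro sum.cong refl) (simp add: algebra_simps)
  finally show ?thesis .
qed

section \<open>Eichler transvections\<close>

text \<open>The argument \<open>q\<close> stands for (a, a)/2. Keeping it separate gives one formula
  for \<open>int\<close>, where halving is impossible, and for its scalar extensions.\<close>

definition eichler :: "int^'n^'n \<Rightarrow> 'a::comm_ring_1^'n \<Rightarrow> 'a^'n \<Rightarrow> 'a \<Rightarrow> 'a^'n^'n" where
  "eichler S v a q = (\<chi> i j. (if i = j then 1 else 0) - bform S a (axis j 1) * v $ i
      + bform S v (axis j 1) * a $ i - q * bform S v (axis j 1) * v $ i)"

lemma eichler_mult:
  "eichler S v a q *v x = x - bform S a x *s v + bform S v x *s a - (q * bform S v x) *s v"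
proof (subst vec_eq_iff, intro allI)
  fix i
  have "(eichler S v a q *v x) $ i =
      (\<Sum>j\<in>UNIV. if i = j then x $ j else 0) - (\<Sum>j\<in>UNIV. bform S a (axis j 1) * x $ j) * v $ i
      + (\<Sum>j\<in>UNIV. bform S v (axis j 1) * x $ j) * a $ i
      - q * (\<Sum>j\<in>UNIV. bform S v (axis j 1) * x $ j) * v $ i"
    unfolding eichler_def matrix_vector_mult_def sum_distrib_right sum_distrib_left
      sum_subtractf[symmetric] sum.distrib[symmetric]
    by (auto intro!: sum.cong simp: algebra_simps)
  then show "(eichler S v a q *v x) $ i =
      (x - bform S a x *s v + bform S v x *s a - (q * bform S v x) *s v) $ i"
    by (simp add: bform_expand_right[of S a x] bform_expand_right[of S v x])
qed

lemma matrix_vector_mult_scale: "A *v (c *s x) = (c :: 'a::comm_ring_1) *s (A *v x)"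
  by (simp add: vec_eq_iff matrix_vector_mult_def sum_distrib_left mult_ac)

lemma bform_of_int_axis:
  "bform S (map_vector of_int u) (axis j 1) = of_int (bform S u (axis j 1))"
proof -
  have "axis j 1 = map_vector of_int (axis j 1)"
    by (simp add: vec_eq_iff axis_def)
  then show ?thesis by (metis bform_of_int)
qed

lemma eichler_of_int:
  "map_matrix of_int (eichler S v a q) =
     eichler S (map_vector of_int v) (map_vector of_int a) (of_int q)"
  by (simp add: vec_eq_iff eichler_def bform_of_int_axis)

lemma eichler_zero [simp]: "eichler S v 0 0 = mat 1"
  by (simp add: vec_eq_iff eichler_def mat_def)

locale symmetric_form =
  fixes S :: "int^'n^'n"
  assumes bform_int_commute: "bform S (x :: int^'n) y = bform S y x"
begin

lemma bform_commute: "bform S (x :: 'a::comm_ring_1^'n) y = bform S y x"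
  using bform_commute_gen bform_int_commute by blast

lemma eichler_orthogonal:
  assumes "bform S v v = 0" "bform S v a = 0" "bform S a a = 2 * q"
  shows "bform S (eichler S v a q *v x) (eichler S v a q *v y) = bform S x y"
proof -
  have *: "bform S a v = 0" "bform S x v = bform S v x" "bform S x a = bform S a x"
    using assms(2) by (simp_all add: bform_commute)
  show ?thesis
    by (simp add: eichler_mult bform_simps assms * algebra_simps)
qed

text \<open>Along a fixed isotropic v, composing transvections adds their second vectors; the last
  argument follows the rule for the half norm of a sum.\<close>

lemma eichler_add:
  assumes "bform S v v = 0" "bform S v a = 0" "bform S v b = 0"
  shows "eichler S v a q ** eichler S v b q' = eichler S v (a + b) (q + q' + bform S a b)"
proof -
  have *: "bform S a v = 0" "bform S b v = 0"
    using assms(2,3) by (simp_all add: bform_commute)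
  have "(eichler S v a q ** eichler S v b q') *v x
      = eichler S v (a + b) (q + q' + bform S a b) *v x" for x
    by (simp flip: matrix_vector_mul_assoc
        add: vec_eq_iff eichler_mult bform_simps assms * algebra_simps)
  then show ?thesis by (simp add: matrix_eq)
qed

lemma eichler_equivariant:
  assumes "\<And>x y. bform S (g *v x) (g *v y) = bform S x y"
  shows "g ** eichler S v a q = eichler S (g *v v) (g *v a) q ** g"
proof -
  have "(g ** eichler S v a q) *v x = (eichler S (g *v v) (g *v a) q ** g) *v x" for x
    by (simp flip: matrix_vector_mul_assoc add: eichler_mult assms matrix_vector_right_distrib
        matrix_vector_mult_diff_distrib matrix_vector_mult_scale)
  then show ?thesis by (simp add: matrix_eq)
qed

text \<open>With \<open>q = 0\<close> the transvection is 1 plus the bivector of v and w, which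
  changes sign when the two are exchanged.\<close>

lemma eichler_swap: "eichler S v w 0 = eichler S w (- v) 0"
  by (simp add: vec_eq_iff eichler_def bform_simps)

end

section \<open>Transvections in the discriminant kernel\<close>

lemma foldr_comp_append:
  "foldr (\<lambda>v h. f v \<circ> h) (vs @ ws) id = foldr (\<lambda>v h. f v \<circ> h) vs id \<circ> foldr (\<lambda>v h. f v \<circ> h) ws id"
  by (induction vs) (simp_all add: comp_assoc)

lemma has_spinor_norm_mult:
  assumes "has_spinor_norm S g 1" "has_spinor_norm S h 1"
  shows "has_spinor_norm S (g ** h) 1"
proof -
  obtain vs t where vs: "\<forall>v\<in>set vs. bform S v v \<noteq> 0"
      "(*v) g = foldr (\<lambda>v h. reflection S v \<circ> h) vs id"
      "t \<noteq> 0" "1 = (\<Prod>v\<leftarrow>vs. - (bform S v v / 2)) * t\<^sup>2"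
    using assms(1) unfolding has_spinor_norm_def by blast
  obtain ws u where ws: "\<forall>v\<in>set ws. bform S v v \<noteq> 0"
      "(*v) h = foldr (\<lambda>v h. reflection S v \<circ> h) ws id"
      "u \<noteq> 0" "1 = (\<Prod>v\<leftarrow>ws. - (bform S v v / 2)) * u\<^sup>2"
    using assms(2) unfolding has_spinor_norm_def by blast
  have "(*v) (g ** h) = (*v) g \<circ> (*v) h"
    by (simp add: fun_eq_iff matrix_vector_mul_assoc)
  also have "\<dots> = foldr (\<lambda>v h. reflection S v \<circ> h) (vs @ ws) id"
    using vs(2) ws(2) by (simp only: foldr_comp_append)
  finally have "(*v) (g ** h) = foldr (\<lambda>v h. reflection S v \<circ> h) (vs @ ws) id" .
  moreover have "1 = (\<Prod>v\<leftarrow>vs @ ws. - (bform S v v / 2)) * (t * u)\<^sup>2"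
    using arg_cong2[OF vs(4) ws(4), of "(*)"] by (simp add: power_mult_distrib mult_ac)
  moreover have "\<forall>v\<in>set (vs @ ws). bform S v v \<noteq> 0" using vs(1) ws(1) by auto
  moreover have "t * u \<noteq> 0" using vs ws by simp
  ultimately show ?thesis
    unfolding has_spinor_norm_def by blast
qed

lemma orthogonal_group_mult:
  assumes "g \<in> orthogonal_group S" "h \<in> orthogonal_group S"
  shows "g ** h \<in> orthogonal_group S"
proof -
  obtain g' h' where "g ** g' = mat 1" "g' ** g = mat 1" "h ** h' = mat 1" "h' ** h = mat 1"
    using assms unfolding orthogonal_group_def invertible_def by blast
  then have "(g ** h) ** (h' ** g') = mat 1" "(h' ** g') ** (g ** h) = mat 1"
    by (metis matrix_mul_assoc matrix_mul_lid)+
  then have "invertible (g ** h)" unfolding invertible_def by blast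
  then show ?thesis
    using assms by (auto simp: orthogonal_group_def simp flip: matrix_vector_mul_assoc)
qed

lemma O_tilde_plus_mult:
  assumes "g \<in> O_tilde_plus S" "h \<in> O_tilde_plus S"
  shows "g ** h \<in> O_tilde_plus S"
proof -
  have "(*v) (map_matrix of_int (g ** h)) ` A = A" if "A \<in> discriminant_group S" for A
  proof -
    have "(*v) (map_matrix of_int (g ** h)) ` A
        = (*v) (map_matrix of_int g) ` ((*v) (map_matrix of_int h) ` A)"
      by (simp add: image_image of_int_matrix_mult matrix_vector_mul_assoc)
    then show ?thesis
      using assms that by (simp add: O_tilde_plus_def O_tilde_def)
  qed
  then show ?thesis
    using assms orthogonal_group_mult[of g S h]
      has_spinor_norm_mult[of S "map_matrix real_of_int g" "map_matrix real_of_int h"]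
      orthogonal_group_mult[of "map_matrix real_of_int g" S "map_matrix real_of_int h"]
    by (simp add: O_tilde_plus_def O_tilde_def O_plus_real_def of_int_matrix_mult)
qed

lemma SO_tilde_plus_mult:
  assumes "g \<in> SO_tilde_plus S" "h \<in> SO_tilde_plus S"
  shows "g ** h \<in> SO_tilde_plus S"
  using assms O_tilde_plus_mult[of g S h] by (simp add: SO_tilde_plus_def det_mul)

context symmetric_form
begin

lemma eichler_inverse:
  assumes "bform S v v = 0" "bform S v a = 0" "bform S a a = 2 * q"
  shows "eichler S v a q ** eichler S v (- a) q = mat 1"
  using eichler_add[of v a "- a" q q] assms by (simp add: bform_simps)

lemma eichler_in_orthogonal_group:
  assumes "bform S v v = 0" "bform S v a = 0" "bform S a a = 2 * q"
  shows "eichler S v a q \<in> orthogonal_group S"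
proof -
  have "eichler S v (- a) q ** eichler S v a q = mat 1"
    using eichler_inverse[of v "- a" q] assms by (simp add: bform_simps)
  then have "invertible (eichler S v a q)"
    using eichler_inverse[OF assms] unfolding invertible_def by blast
  then show ?thesis
    using eichler_orthogonal[OF assms] by (simp add: orthogonal_group_def)
qed

text \<open>Both mirror vectors have norm \<open>2 * q\<close>, because v is isotropic and
  orthogonal to a. Each reflection therefore contributes \<open>- q\<close> to the spinor norm, and
  the product is a square.\<close>

lemma eichler_eq_reflections:
  fixes v a :: "real^'n"
  assumes "bform S v v = 0" "bform S v a = 0" "bform S a a = 2 * q" "q \<noteq> 0"
  shows "eichler S v a q *v x = reflection S a (reflection S (a + q *s v) x)"
proof -
  have *: "bform S a v = 0" "bform S x v = bform S v x" "bform S x a = bform S a x"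
    using assms(2) by (simp_all add: bform_commute)
  show ?thesis
    using assms(4)
    by (simp add: vec_eq_iff eichler_mult reflection_def bform_simps assms * field_simps)
qed

lemma has_spinor_norm_eichler_anisotropic:
  fixes v a :: "real^'n"
  assumes "bform S v v = 0" "bform S v a = 0" "bform S a a = 2 * q" "q \<noteq> 0"
  shows "has_spinor_norm S (eichler S v a q) 1"
proof -
  let ?vs = "[a, a + q *s v]"
  have *: "bform S a v = 0" using assms(2) by (simp add: bform_commute)
  have "(*v) (eichler S v a q) = foldr (\<lambda>v h. reflection S v \<circ> h) ?vs id"
    using eichler_eq_reflections[OF assms] by (simp add: fun_eq_iff)
  moreover have "\<forall>v\<in>set ?vs. bform S v v \<noteq> 0"
    using assms * by (simp add: bform_simps)
  moreover have "1 = (\<Prod>v\<leftarrow>?vs. - (bform S v v / 2)) * (1 / q)\<^sup>2"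
    using assms * by (simp add: bform_simps power2_eq_square)
  moreover have "1 / q \<noteq> 0" using assms by simp
  ultimately show ?thesis unfolding has_spinor_norm_def by blast
qed

lemma has_spinor_norm_eichler:
  fixes v a b :: "real^'n"
  assumes v: "bform S v v = 0" "bform S v a = 0" "bform S a a = 2 * q"
    and b: "bform S v b = 0" "bform S b b \<noteq> 0"
  shows "has_spinor_norm S (eichler S v a q) 1"
proof (cases "q = 0")
  case False
  then show ?thesis using has_spinor_norm_eichler_anisotropic[OF v] by simp
next
  case True
  \<comment> \<open>An isotropic a is split as (a + c) + (- c) with both parts anisotropic. One of b
    and -b serves as c: the norms of a + b and a - b add up to 2 (b, b), which is nonzero.\<close>
  have "\<exists>c. bform S v c = 0 \<and> bform S c c \<noteq> 0 \<and> bform S (a + c) (a + c) \<noteq> 0"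
  proof (cases "bform S (a + b) (a + b) = 0")
    case True
    then have "bform S (a + - b) (a + - b) \<noteq> 0"
      using \<open>q = 0\<close> v b by (simp add: bform_simps bform_commute[of b a])
    then show ?thesis using b by (intro exI[of _ "- b"]) (simp add: bform_simps)
  qed (use b in blast)
  then obtain c where c: "bform S v c = 0" "bform S c c \<noteq> 0" "bform S (a + c) (a + c) \<noteq> 0"
    by blast
  have "has_spinor_norm S (eichler S v (a + c) (bform S (a + c) (a + c) / 2)) 1"
    using v c by (intro has_spinor_norm_eichler_anisotropic) (simp_all add: bform_add_right)
  moreover have "has_spinor_norm S (eichler S v (- c) (bform S c c / 2)) 1"
    using v c by (intro has_spinor_norm_eichler_anisotropic) (simp_all add: bform_simps)
  moreover have "eichler S v (a + c) (bform S (a + c) (a + c) / 2)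
      ** eichler S v (- c) (bform S c c / 2) = eichler S v a q"
    using eichler_add[of v "a + c" "- c" "bform S (a + c) (a + c) / 2" "bform S c c / 2"] v c
    by (simp add: bform_simps bform_commute[of c a] True add_divide_distrib)
  ultimately show ?thesis using has_spinor_norm_mult by metis
qed

lemma eichler_dual:
  fixes x :: "rat^'n" and v a :: "int^'n"
  assumes "x \<in> dual_lattice S"
  shows "\<exists>l :: int^'n. eichler S (map_vector of_int v) (map_vector of_int a) (of_int q) *v x
           = x + map_vector of_int l"
proof -
  obtain m n where mn: "bform S (map_vector of_int v) x = of_int m"
      "bform S (map_vector of_int a) x = of_int n"
    using assms by (metis (mono_tags, lifting) Ints_cases bform_commute dual_lattice_def mem_Collect_eq)
  show ?thesis
    by (rule exI[of _ "m *s a - n *s v - (q * m) *s v"])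
      (simp add: eichler_mult mn vec_eq_iff)
qed

lemma det_eichler:
  fixes v a :: "int^'n"
  assumes "bform S v v = 0" "bform S v a = 0" "bform S a a = 2 * q"
  shows "det (eichler S v a q) = 1"
proof -
  \<comment> \<open>Over the reals the transvection is the square of the one along a/2, whose half
    norm is q/4. So the determinant is nonnegative, and as an integral unit it is 1.\<close>
  let ?v = "map_vector of_int v :: real^'n" and ?a = "(1/2) *s (map_vector of_int a :: real^'n)"
  have "eichler S ?v ?a (of_int q / 4) ** eichler S ?v ?a (of_int q / 4)
      = eichler S ?v (map_vector of_int a) (of_int q)"
    using assms by (subst eichler_add) (simp_all add: bform_simps bform_of_int field_simps
        flip: vector_sadd_rdistrib)
  then have "real_of_int (det (eichler S v a q)) = det (eichler S ?v ?a (of_int q / 4)) ^ 2"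
    by (simp add: eichler_of_int power2_eq_square flip: det_of_int det_mul)
  then have "det (eichler S v a q) \<ge> 0"
    by (metis of_int_0_le_iff zero_le_power2)
  moreover have "det (eichler S v a q) * det (eichler S v (- a) q) = 1"
    using eichler_inverse[OF assms] by (metis det_I det_mul)
  ultimately show ?thesis
    by (metis abs_of_nonneg abs_zmult_eq_1 abs_1)
qed

lemma eichler_in_SO_tilde_plus:
  fixes v a b :: "int^'n"
  assumes v: "bform S v v = 0" "bform S v a = 0" "bform S a a = 2 * q"
    and b: "bform S v b = 0" "bform S b b \<noteq> 0"
  shows "eichler S v a q \<in> SO_tilde_plus S"
proof -
  let ?v = "map_vector of_int v" and ?a = "map_vector of_int a"
  \<comment> \<open>Stated for every second vector c: the reverse inclusion follows by applying it
    to the inverse, which is the transvection along -a.\<close>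
  have disc: "(*v) (map_matrix of_int (eichler S v c q)) ` A \<subseteq> A"
    if "A \<in> discriminant_group S" for A and c :: "int^'n"
  proof -
    obtain x where x: "x \<in> dual_lattice S" and A: "A = {x + map_vector of_int l | l :: int^'n. True}"
      using \<open>A \<in> discriminant_group S\<close> by (auto simp: discriminant_group_def)
    show ?thesis
    proof
      fix y assume "y \<in> (*v) (map_matrix of_int (eichler S v c q)) ` A"
      then obtain l :: "int^'n" where
        "y = map_matrix of_int (eichler S v c q) *v (x + map_vector of_int l)"
        using A by blast
      then have y: "y = eichler S (map_vector of_int v) (map_vector of_int c) (of_int q) *v x
          + map_vector of_int (eichler S v c q *v l)"
        by (simp add: matrix_vector_right_distrib eichler_of_int of_int_matrix_vector_mult
            flip: of_int_matrix_vector_mult)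
      obtain l' :: "int^'n" where
        "eichler S (map_vector of_int v) (map_vector of_int c) (of_int q) *v x
          = x + map_vector of_int l'"
        using eichler_dual[OF x] by blast
      then have "y = x + map_vector of_int (l' + eichler S v c q *v l)"
        using y by (simp add: map_vector_of_int_add)
      then show "y \<in> A" using A by blast
    qed
  qed
  have "(*v) (map_matrix of_int (eichler S v a q)) ` A = A"
    if A: "A \<in> discriminant_group S" for A :: "(rat^'n) set"
  proof
    show "A \<subseteq> (*v) (map_matrix of_int (eichler S v a q)) ` A"
    proof
      fix y assume y: "y \<in> A"
      have "y = map_matrix of_int (eichler S v a q) *v
          (map_matrix of_int (eichler S v (- a) q) *v y)"
        by (simp add: matrix_vector_mul_assoc eichler_inverse[OF v] flip: of_int_matrix_mult)
      then show "y \<in> (*v) (map_matrix of_int (eichler S v a q)) ` A"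
        using disc[OF A, of "- a"] y by blast
    qed
  qed (use disc[OF A] in blast)
  moreover have "map_matrix of_int (eichler S v a q) \<in> O_plus_real S"
    unfolding eichler_of_int O_plus_real_def
    using v b by (auto intro!: eichler_in_orthogonal_group
        has_spinor_norm_eichler[where b = "map_vector of_int b"] simp: bform_of_int)
  ultimately show ?thesis
    using eichler_in_orthogonal_group[OF v] det_eichler[OF v]
    by (simp add: SO_tilde_plus_def O_tilde_plus_def O_tilde_def)
qed

end

section \<open>Integral linear algebra\<close>

text \<open>Elimination without division, so that it works over the integers: one equation removes
  one unknown j with nonzero coefficient, and the others are cross-multiplied.\<close>

lemma nontrivial_solution:
  fixes u :: "'k \<Rightarrow> 'i \<Rightarrow> 'a::idom"
  assumes "finite K" "finite I" "card K < card I"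
  shows "\<exists>c. (\<exists>i\<in>I. c i \<noteq> 0) \<and> (\<forall>k\<in>K. (\<Sum>i\<in>I. c i * u k i) = 0)"
  using assms
proof (induction K arbitrary: I u rule: finite_induct)
  case empty
  then have "I \<noteq> {}" by auto
  then show ?case by (intro exI[of _ "\<lambda>_. 1"]) auto
next
  case (insert k K)
  show ?case
  proof (cases "\<forall>i\<in>I. u k i = 0")
    case True
    obtain c where "\<exists>i\<in>I. c i \<noteq> 0" "\<forall>k\<in>K. (\<Sum>i\<in>I. c i * u k i) = 0"
      using insert.IH[of I u] insert.prems insert.hyps by (metis Suc_lessD card_insert_disjoint)
    then show ?thesis using True by (intro exI[of _ c]) auto
  next
    case False
    then obtain j where j: "j \<in> I" "u k j \<noteq> 0" by blast
    let ?J = "I - {j}"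
    have "finite ?J" "card K < card ?J"
      using insert j by auto
    then obtain c where c: "\<exists>i\<in>?J. c i \<noteq> 0"
        "\<forall>l\<in>K. (\<Sum>i\<in>?J. c i * (u k j * u l i - u k i * u l j)) = 0"
      using insert.IH[of ?J "\<lambda>l i. u k j * u l i - u k i * u l j"] by blast
    \<comment> \<open>Scaling the solution for the other unknowns by \<open>u k j\<close> lets the
      j-th unknown be solved for without a quotient.\<close>
    define d where "d i = (if i = j then - (\<Sum>i\<in>?J. u k i * c i) else u k j * c i)" for i
    have sum_d: "(\<Sum>i\<in>I. d i * u l i) = (\<Sum>i\<in>?J. c i * (u k j * u l i - u k i * u l j))" for l
    proof -
      have "(\<Sum>i\<in>I. d i * u l i) = d j * u l j + (\<Sum>i\<in>?J. d i * u l i)"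
        using insert.prems j by (simp add: sum.remove)
      also have "(\<Sum>i\<in>?J. d i * u l i) = (\<Sum>i\<in>?J. u k j * c i * u l i)"
        by (intro sum.cong) (auto simp: d_def)
      also have "d j * u l j + (\<Sum>i\<in>?J. u k j * c i * u l i)
          = (\<Sum>i\<in>?J. c i * (u k j * u l i - u k i * u l j))"
        by (simp add: d_def sum_distrib_right sum_distrib_left sum_subtractf algebra_simps)
      finally show ?thesis .
    qed
    have "(\<Sum>i\<in>I. d i * u l i) = 0" if "l \<in> insert k K" for l
      using that c(2) sum_d[of l] by (auto simp: mult.commute)
    moreover have "\<exists>i\<in>I. d i \<noteq> 0"
      using c(1) j by (auto simp: d_def)
    ultimately show ?thesis by blast
  qed
qed

lemma bezout_finite:
  fixes c :: "'i \<Rightarrow> int"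
  assumes "finite I"
  shows "\<exists>a. (\<Sum>i\<in>I. a i * c i) = Gcd (c ` I)"
  using assms
proof (induction I rule: finite_induct)
  case (insert j I)
  then obtain a where a: "(\<Sum>i\<in>I. a i * c i) = Gcd (c ` I)" by blast
  obtain s t where st: "s * c j + t * Gcd (c ` I) = gcd (c j) (Gcd (c ` I))"
    using bezout_int by blast
  have "(\<Sum>i\<in>insert j I. (if i = j then s else t * a i) * c i)
      = s * c j + (\<Sum>i\<in>I. (if i = j then s else t * a i) * c i)"
    using insert by simp
  also have "(\<Sum>i\<in>I. (if i = j then s else t * a i) * c i) = t * (\<Sum>i\<in>I. a i * c i)"
    unfolding sum_distrib_left using insert by (intro sum.cong) auto
  finally show ?case
    using a st by (intro exI[of _ "\<lambda>i. if i = j then s else t * a i"]) simp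
qed simp

text \<open>The coefficients \<open>a\<close> certify that c' is primitive. They exclude a prime
  dividing all its entries, and they give a functional with value 1 on it.\<close>

lemma primitive_part:
  fixes c :: "'i \<Rightarrow> int"
  assumes "finite I" "\<exists>i\<in>I. c i \<noteq> 0"
  shows "\<exists>g c' a. g \<noteq> 0 \<and> (\<forall>i\<in>I. c i = g * c' i) \<and> (\<Sum>i\<in>I. a i * c' i) = 1"
proof -
  let ?g = "Gcd (c ` I)"
  obtain a where a: "(\<Sum>i\<in>I. a i * c i) = ?g" using bezout_finite[OF assms(1)] by blast
  have g: "?g \<noteq> 0" using assms(2) by (auto simp: Gcd_0_iff)
  define c' where "c' i = c i div ?g" for i
  have c': "c i = ?g * c' i" if "i \<in> I" for i
    unfolding c'_def using that by (intro dvd_mult_div_cancel[symmetric] Gcd_dvd imageI)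
  have "a i * c i = ?g * (a i * c' i)" if "i \<in> I" for i
    by (subst c'[OF that]) (rule mult.left_commute)
  then have "?g * (\<Sum>i\<in>I. a i * c' i) = (\<Sum>i\<in>I. a i * c i)"
    unfolding sum_distrib_left by (intro sum.cong refl) (rule sym)
  then have "(\<Sum>i\<in>I. a i * c' i) = 1"
    using a g by (metis mult_cancel_left2)
  then show ?thesis using g c' by (intro exI[of _ ?g] exI[of _ c'] exI[of _ a]) blast
qed

text \<open>Modulo p, c is a nonzero kernel vector of A. Multiplying by the adjugate turns A c into
  det A times c, and the entry c i can be cancelled.\<close>

lemma prime_dvd_det:
  fixes A :: "int Matrix.mat"
  assumes A: "A \<in> carrier_mat k k" and p: "prime p"
    and c: "i < k" "\<not> p dvd c i" "\<And>j. j < k \<Longrightarrow> p dvd (\<Sum>l<k. A $$ (j, l) * c l)"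
  shows "p dvd Determinant.det A"
proof -
  have B: "adj_mat A \<in> carrier_mat k k" "adj_mat A * A = Determinant.det A \<cdot>\<^sub>m 1\<^sub>m k"
    using adj_mat[OF A] by auto
  have entry: "(\<Sum>j<k. adj_mat A $$ (i, j) * A $$ (j, l)) = (if l = i then Determinant.det A else 0)"
    if "l < k" for l
  proof -
    have "(adj_mat A * A) $$ (i, l) = (\<Sum>j<k. adj_mat A $$ (i, j) * A $$ (j, l))"
      using A B(1) that c(1)
      by (simp add: scalar_prod_def times_mat_def lessThan_atLeast0)
    then show ?thesis using B(2) that c(1) by auto
  qed
  have "(\<Sum>j<k. adj_mat A $$ (i, j) * (\<Sum>l<k. A $$ (j, l) * c l))
      = (\<Sum>j<k. \<Sum>l<k. adj_mat A $$ (i, j) * A $$ (j, l) * c l)"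
    by (simp add: sum_distrib_left mult.assoc)
  also have "\<dots> = (\<Sum>l<k. (\<Sum>j<k. adj_mat A $$ (i, j) * A $$ (j, l)) * c l)"
    unfolding sum_distrib_right by (rule sum.swap)
  also have "\<dots> = (\<Sum>l<k. if l = i then Determinant.det A * c l else 0)"
    using entry by (intro sum.cong) auto
  also have "\<dots> = Determinant.det A * c i"
    using c(1) by simp
  finally have "p dvd Determinant.det A * c i"
    by (metis (no_types, lifting) c(3) dvd_mult dvd_sum lessThan_iff)
  then show ?thesis using c(2) p by (simp add: prime_dvd_mult_iff)
qed

section \<open>Rank modulo a prime and the complement of two hyperbolic planes\<close>

lemma int_independent_length_le:
  fixes vs :: "(int^'n) list"
  assumes "int_independent vs"
  shows "length vs \<le> CARD('n)"
proof (rule ccontr)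
  assume "\<not> length vs \<le> CARD('n)"
  then obtain c where c: "\<exists>i<length vs. c i \<noteq> 0"
      "\<And>k::'n. (\<Sum>i<length vs. c i * (vs ! i) $ k) = 0"
    using nontrivial_solution[of "UNIV :: 'n set" "{..<length vs}" "\<lambda>k i. (vs ! i) $ k"] by auto
  then have "(\<Sum>i<length vs. c i *s (vs ! i)) = 0"
    by (simp add: vec_eq_iff)
  then show False using assms c(1) unfolding int_independent_def by blast
qed

lemma rank_mod_witness:
  fixes S :: "int^'n^'n"
  shows "\<exists>vs. length vs = rank_mod p S \<and> coprime (gram_det S vs) (int p)"
proof -
  let ?A = "{length vs | vs. int_independent vs \<and> coprime (gram_det S vs) (int p)}"
  have "finite ?A"
    by (rule finite_subset[of _ "{..CARD('n)}"]) (auto intro: int_independent_length_le)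
  \<comment> \<open>The empty family has Gram determinant 1, so the maximum is taken over a nonempty
    set.\<close>
  moreover have "length ([] :: (int^'n) list) \<in> ?A"
    by (intro CollectI exI[of _ "[]"]) (simp add: int_independent_def gram_det_def)
  ultimately have "Max ?A \<in> ?A" by (intro Max_in) auto
  then show ?thesis unfolding rank_mod_def by auto
qed

definition plane_pair ::
  "int^'n^'n \<Rightarrow> int^'n \<Rightarrow> int^'n \<Rightarrow> int^'n \<Rightarrow> int^'n \<Rightarrow> bool" where
  "plane_pair S e f e' f' \<longleftrightarrow> hyperbolic_pair S e f \<and> hyperbolic_pair S e' f' \<and>
     (\<forall>u\<in>{e, f}. \<forall>v\<in>{e', f'}. bform S u v = 0)"

context symmetric_form
begin

lemma plane_pair_bform:
  assumes "plane_pair S e f e' f'"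
  shows "bform S e e = 0" "bform S f f = 0" "bform S e f = 1" "bform S f e = 1"
    "bform S e' e' = 0" "bform S f' f' = 0" "bform S e' f' = 1" "bform S f' e' = 1"
    "bform S e e' = 0" "bform S e f' = 0" "bform S f e' = 0" "bform S f f' = 0"
    "bform S e' e = 0" "bform S f' e = 0" "bform S e' f = 0" "bform S f' f = 0"
  using assms bform_commute[of e f] bform_commute[of e' f'] bform_commute[of e e']
    bform_commute[of e f'] bform_commute[of f e'] bform_commute[of f f']
  by (simp_all add: plane_pair_def hyperbolic_pair_def)

lemma plane_pair_flip: "plane_pair S e f e' f' \<Longrightarrow> plane_pair S f e e' f'"
  and plane_pair_flip': "plane_pair S e f e' f' \<Longrightarrow> plane_pair S e f f' e'"
  and plane_pair_swap: "plane_pair S e f e' f' \<Longrightarrow> plane_pair S e' f' e f"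
  using plane_pair_bform[of e f e' f']
  by (auto simp: plane_pair_def[of S f e] plane_pair_def[of S e f f'] plane_pair_def[of S e' f']
      hyperbolic_pair_def)

text \<open>The planes are unimodular, so the orthogonal projection onto them has integral
  coordinates: the coefficient of each basis vector is the pairing with its partner.\<close>

lemma plane_pair_complement:
  assumes "plane_pair S e f e' f'"
  obtains y where "x = bform S f x *s e + bform S e x *s f + bform S f' x *s e'
      + bform S e' x *s f' + y"
    "bform S e y = 0" "bform S f y = 0" "bform S e' y = 0" "bform S f' y = 0"
proof -
  define y where "y = x - bform S f x *s e - bform S e x *s f - bform S f' x *s e'
      - bform S e' x *s f'"
  then have "x = bform S f x *s e + bform S e x *s f + bform S f' x *s e'
      + bform S e' x *s f' + y" by simp
  moreover have "bform S e y = 0" "bform S f y = 0" "bform S e' y = 0" "bform S f' y = 0"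
    by (simp_all add: y_def bform_simps plane_pair_bform[OF assms])
  ultimately show thesis using that by blast
qed

text \<open>
  Two hyperbolic planes only account for rank 4: five vectors have a primitive integral relation
  in the coordinates of the planes, so a Gram determinant prime to \<open>p\<close> forces a value prime to
  \<open>p\<close> on the complement.
\<close>

lemma rank_mod_complement:
  assumes pp: "plane_pair S e f e' f'" and p: "prime p" and rank: "rank_mod p S \<ge> 5"
  shows "\<exists>b c :: int^'n. (\<forall>u\<in>{e, f, e', f'}. bform S u b = 0 \<and> bform S u c = 0) \<and>
           \<not> int p dvd bform S b c" (is "\<exists>b c. ?Q b c")
proof (rule ccontr)
  assume "\<not> (\<exists>b c. ?Q b c)"
  then have neg: "\<not> ?Q b c" for b c by simp
  have dvd: "int p dvd bform S b c"
    if "\<forall>u\<in>{e, f, e', f'}. bform S u b = 0 \<and> bform S u c = 0" for b c :: "int^'n"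
  proof (rule ccontr)
    assume "\<not> int p dvd bform S b c"
    with that neg[of b c] show False by simp
  qed
  obtain vs where vs: "length vs \<ge> 5" "coprime (gram_det S vs) (int p)"
    using rank_mod_witness[of p S] rank by metis
  let ?k = "length vs" and ?P = "{e, f, e', f'}"
  have "card ?P < ?k"
    using vs(1) card_length[of "[e, f, e', f']"] by simp
  then obtain c0 where c0: "\<exists>i\<in>{..<?k}. c0 i \<noteq> 0"
      "\<forall>u\<in>?P. (\<Sum>i<?k. c0 i * bform S u (vs ! i)) = 0"
    using nontrivial_solution[of ?P "{..<?k}" "\<lambda>u i. bform S u (vs ! i)"] by auto
  obtain g c a where gca: "g \<noteq> 0" "\<forall>i\<in>{..<?k}. c0 i = g * c i" "(\<Sum>i<?k. a i * c i) = 1"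
    using primitive_part[OF _ c0(1)] by auto
  have "\<exists>i<?k. \<not> int p dvd c i"
  proof (rule ccontr)
    assume "\<not> (\<exists>i<?k. \<not> int p dvd c i)"
    then have "int p dvd (\<Sum>i<?k. a i * c i)" by (intro dvd_sum) auto
    then show False using gca(3) p by (simp add: prime_gt_1_nat)
  qed
  then obtain i where i: "i < ?k" "\<not> int p dvd c i" by blast
  define x where "x = (\<Sum>i<?k. c i *s (vs ! i))"
  have x: "bform S u x = 0" if "u \<in> ?P" for u
  proof -
    have "g * (\<Sum>i<?k. c i * bform S u (vs ! i)) = (\<Sum>i<?k. c0 i * bform S u (vs ! i))"
      unfolding sum_distrib_left using gca(2) by (intro sum.cong) auto
    then show ?thesis
      using bspec[OF c0(2) that] gca(1) by (simp add: x_def bform_sum_right bform_simps)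
  qed
  \<comment> \<open>Since x is orthogonal to the planes, only the component of w in their complement
    pairs with it. Applied to all members of \<open>vs\<close>, this makes c a kernel vector of the
    Gram matrix modulo p.\<close>
  have "int p dvd bform S w x" for w
  proof -
    obtain y where y: "w = bform S f w *s e + bform S e w *s f + bform S f' w *s e'
      + bform S e' w *s f' + y"
      "bform S e y = 0" "bform S f y = 0" "bform S e' y = 0" "bform S f' y = 0"
      by (rule plane_pair_complement[OF pp, of w])
    have "bform S w x = bform S y x"
      by (subst y(1)) (simp add: bform_simps x)
    then show ?thesis using dvd[of y x] y(2-5) x by auto
  qed
  then have "int p dvd (\<Sum>l<?k. bform S (vs ! j) (vs ! l) * c l)" for j
    by (simp add: x_def bform_sum_right bform_simps mult.commute)
  then have "int p dvd gram_det S vs"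
    unfolding gram_det_def using i p
    by (intro prime_dvd_det[where k = ?k and i = i and c = c]) auto
  then show False
    using coprime_common_divisor[OF vs(2), of "int p"] p by (simp add: prime_gt_1_nat not_prime_unit)
qed

end

section \<open>Characters are trivial on transvections\<close>

lemma power_int_eq_1_four:
  fixes x :: "'a::field"
  assumes "x ^ 4 = 1" "x powi m = 1" "odd m" "x \<noteq> 0"
  shows "x = 1"
proof -
  have "x powi m = x powi (4 * (m div 4) + m mod 4)" by simp
  also have "\<dots> = (x powi 4) powi (m div 4) * x powi (m mod 4)"
    using assms(4) by (subst power_int_add) (auto simp: power_int_mult)
  also have "x powi 4 = 1" using assms(1) by simp
  finally have "x powi (m mod 4) = 1" using assms(2) by simp
  moreover have "m mod 4 = 1 \<or> m mod 4 = 3" using assms(3) by presburger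
  ultimately have "x = 1 \<or> x ^ 3 = 1" by auto
  then show ?thesis
    using assms(1) by (auto simp: eval_nat_numeral)
qed

lemma power_int_eq_1_three:
  fixes x :: "'a::field"
  assumes "x ^ 3 = 1" "x powi m = 1" "\<not> 3 dvd m" "x \<noteq> 0"
  shows "x = 1"
proof -
  have "x powi m = x powi (3 * (m div 3) + m mod 3)" by simp
  also have "\<dots> = (x powi 3) powi (m div 3) * x powi (m mod 3)"
    using assms(4) by (subst power_int_add) (auto simp: power_int_mult)
  also have "x powi 3 = 1" using assms(1) by simp
  finally have "x powi (m mod 3) = 1" using assms(2) by simp
  moreover have "m mod 3 = 1 \<or> m mod 3 = 2" using assms(3) by presburger
  ultimately have "x = 1 \<or> x ^ 2 = 1" by auto
  then show ?thesis
    using assms(1) by (auto simp: eval_nat_numeral)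
qed

text \<open>The descent step: subtracting a nonzero remainder from the divisor shrinks it without
  reaching 0. The remainder has the sign of the divisor, so both signs of p work.\<close>

lemma abs_diff_mod_less:
  fixes p t :: int
  assumes "p \<noteq> 0" "t mod p \<noteq> 0"
  shows "p - t mod p \<noteq> 0" "\<bar>p - t mod p\<bar> < \<bar>p\<bar>"
proof -
  consider "p > 0" | "p < 0" using assms(1) by linarith
  then have "p - t mod p \<noteq> 0 \<and> \<bar>p - t mod p\<bar> < \<bar>p\<bar>"
  proof cases
    case 1
    then show ?thesis using assms pos_mod_bound[of p t] pos_mod_sign[of p t] by linarith
  next
    case 2
    then show ?thesis using assms neg_mod_bound[of p t] neg_mod_sign[of p t] by linarith
  qed
  then show "p - t mod p \<noteq> 0" "\<bar>p - t mod p\<bar> < \<bar>p\<bar>" by auto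
qed

section \<open>Transvections of an even lattice with two hyperbolic planes\<close>

locale even_symmetric_form = symmetric_form S for S :: "int^'n^'n" +
  assumes even_norm: "even (bform S (x :: int^'n) x)"
    and two_planes: "\<exists>e f e' f'. plane_pair S e f e' f'"
begin

definition transvection :: "int^'n \<Rightarrow> int^'n \<Rightarrow> int^'n^'n" where
  "transvection v a = eichler S v a (bform S a a div 2)"

lemma norm_eq: "bform S a a = 2 * (bform S (a :: int^'n) a div 2)"
  by (rule dvd_mult_div_cancel[symmetric, OF even_norm])

text \<open>Supplies the vector b needed for the spinor norm of a transvection. Otherwise the
  complement of v would be totally isotropic, v would be orthogonal to e and f, and e + f of norm 2
  would lie in that complement.\<close>

lemma exists_anisotropic_orthogonal:
  shows "\<exists>b :: int^'n. bform S v b = 0 \<and> bform S b b \<noteq> 0"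
proof (rule ccontr)
  assume *: "\<not> ?thesis"
  then have isotropic: "bform S b b = 0" if "bform S v b = 0" for b :: "int^'n" using that by blast
  have isotropic2: "bform S b c = 0" if "bform S v b = 0" "bform S v c = 0" for b c :: "int^'n"
  proof -
    have "bform S (b + c) (b + c) = 0" using isotropic[of "b + c"] that by (simp add: bform_simps)
    then show ?thesis
      using isotropic[OF that(1)] isotropic[OF that(2)] by (simp add: bform_simps bform_commute[of c b])
  qed
  have key: "bform S v e = 0" if pp: "plane_pair S e f e' f'" for e f e' f'
  proof -
    note pb = plane_pair_bform[OF pp]
    \<comment> \<open>Both vectors are orthogonal to v by construction, and their pairing is the
      square of (v, e).\<close>
    have "bform S (bform S v e' *s e - bform S v e *s e') (bform S v f' *s e - bform S v e *s f') = 0"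
      by (rule isotropic2) (simp_all add: bform_simps)
    then show ?thesis by (simp add: bform_simps pb)
  qed
  obtain e f e' f' where pp: "plane_pair S e f e' f'" using two_planes by blast
  have "bform S (e + f) (e + f) = 0"
    by (rule isotropic)
      (use key[OF pp] key[OF plane_pair_flip[OF pp]] in \<open>simp add: bform_simps\<close>)
  then show False by (simp add: bform_simps plane_pair_bform[OF pp])
qed

lemma transvection_in_SO_tilde_plus:
  assumes "bform S v v = 0" "bform S v a = 0"
  shows "transvection v a \<in> SO_tilde_plus S"
  using exists_anisotropic_orthogonal[of v] eichler_in_SO_tilde_plus[OF assms norm_eq]
  unfolding transvection_def by blast

lemma transvection_mult:
  "transvection v a *v x =
     x - bform S a x *s v + bform S v x *s a - (bform S a a div 2 * bform S v x) *s v"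
  unfolding transvection_def by (rule eichler_mult)

lemma half_norm_add:
  "bform S (a + b) (a + b) div 2 = bform S a a div 2 + bform S b b div 2 + bform S (a :: int^'n) b"
proof -
  have "bform S (a + b) (a + b) = bform S a a + bform S b b + 2 * bform S a b"
    by (simp add: bform_simps bform_commute[of b a])
  then show ?thesis using norm_eq[of a] norm_eq[of b] norm_eq[of "a + b"] by linarith
qed

lemma transvection_add:
  assumes "bform S v v = 0" "bform S v a = 0" "bform S v b = 0"
  shows "transvection v (a + b) = transvection v a ** transvection v b"
  unfolding transvection_def half_norm_add by (rule eichler_add[OF assms, symmetric])

lemma SO_tilde_plus_bform:
  assumes "g \<in> SO_tilde_plus S"
  shows "bform S (g *v x) (g *v y) = bform S x y"
  using assms by (simp add: SO_tilde_plus_def O_tilde_plus_def O_tilde_def orthogonal_group_def)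

lemma transvection_equivariant:
  assumes "g \<in> SO_tilde_plus S"
  shows "g ** transvection v a = transvection (g *v v) (g *v a) ** g"
  unfolding transvection_def
  using eichler_equivariant[of g] SO_tilde_plus_bform[OF assms] by simp

end

text \<open>Multiplicativity is demanded only on \<open>SO_tilde_plus S\<close>, which is contained
  in both groups of the theorem.\<close>

locale form_character = even_symmetric_form S for S :: "int^'n^'n" +
  fixes \<xi> :: "int^'n^'n \<Rightarrow> complex"
  assumes char_mult: "g \<in> SO_tilde_plus S \<Longrightarrow> h \<in> SO_tilde_plus S \<Longrightarrow> \<xi> (g ** h) = \<xi> g * \<xi> h"
    and char_nonzero: "g \<in> SO_tilde_plus S \<Longrightarrow> \<xi> g \<noteq> 0"
    and rank2: "rank_mod 2 S \<ge> 5"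
    and rank3: "rank_mod 3 S \<ge> 5"
begin

definition \<phi> :: "int^'n \<Rightarrow> int^'n \<Rightarrow> complex" where
  "\<phi> v a = \<xi> (transvection v a)"

lemma phi_nonzero: "bform S v v = 0 \<Longrightarrow> bform S v a = 0 \<Longrightarrow> \<phi> v a \<noteq> 0"
  unfolding \<phi>_def using char_nonzero transvection_in_SO_tilde_plus by blast

lemma phi_add:
  assumes "bform S v v = 0" "bform S v a = 0" "bform S v b = 0"
  shows "\<phi> v (a + b) = \<phi> v a * \<phi> v b"
  unfolding \<phi>_def using assms char_mult transvection_in_SO_tilde_plus transvection_add by metis

text \<open>Conjugation by g carries t(v, a) to t(g v, g a), and a character does not see
  conjugation.\<close>

lemma phi_equivariant:
  assumes "g \<in> SO_tilde_plus S" "bform S v v = 0" "bform S v a = 0"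
  shows "\<phi> (g *v v) (g *v a) = \<phi> v a"
proof -
  have "transvection (g *v v) (g *v a) \<in> SO_tilde_plus S"
    using assms by (intro transvection_in_SO_tilde_plus) (simp_all add: SO_tilde_plus_bform)
  then have "\<xi> g * \<phi> v a = \<phi> (g *v v) (g *v a) * \<xi> g"
    unfolding \<phi>_def using assms char_mult transvection_in_SO_tilde_plus transvection_equivariant
    by metis
  then show ?thesis using char_nonzero[OF assms(1)] by simp
qed

lemma phi_swap:
  assumes "bform S v v = 0" "bform S w w = 0"
  shows "\<phi> v w = \<phi> w (- v)"
  using assms eichler_swap[of v w] by (simp add: \<phi>_def transvection_def bform_simps)

lemma phi_zero: "\<phi> v 0 = 1" if "bform S v v = 0"
  using phi_add[of v 0 0] phi_nonzero[of v 0] that by simp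

lemma phi_minus:
  assumes "bform S v v = 0" "bform S v a = 0"
  shows "\<phi> v (- a) = inverse (\<phi> v a)"
  using phi_add[of v a "- a"] phi_zero[of v] assms phi_nonzero[of v a]
  by (simp add: bform_simps field_simps)

lemma phi_scale:
  assumes "bform S v v = 0" "bform S v a = 0"
  shows "\<phi> v (k *s a) = \<phi> v a powi k"
proof -
  have nat: "\<phi> v (int m *s a) = \<phi> v a ^ m" for m
  proof (induction m)
    case (Suc m)
    have "\<phi> v (int (Suc m) *s a) = \<phi> v (a + int m *s a)"
      by (simp add: vector_sadd_rdistrib)
    also have "\<dots> = \<phi> v a * \<phi> v (int m *s a)"
      using assms by (intro phi_add) (simp_all add: bform_simps)
    finally show ?case using Suc by simp
  qed (simp add: phi_zero assms)
  show ?thesis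
  proof (cases "k \<ge> 0")
    case True
    then show ?thesis using nat[of "nat k"] by (simp add: power_int_def)
  next
    case False
    then have "k *s a = - (int (nat (- k)) *s a)" by (simp add: vec_eq_iff)
    then have "\<phi> v (k *s a) = \<phi> v (- (int (nat (- k)) *s a))" by simp
    also have "\<dots> = inverse (\<phi> v (int (nat (- k)) *s a))"
      using assms by (intro phi_minus) (simp_all add: bform_simps)
    also have "\<dots> = inverse (\<phi> v a ^ nat (- k))"
      by (simp only: nat)
    finally show ?thesis using False by (simp add: power_int_def power_inverse)
  qed
qed

text \<open>
  Conjugating the transvection along \<open>v\<close> and \<open>e\<close> by the one along \<open>f\<close> and \<open>a\<close> replaces \<open>e\<close> by
  \<open>e + a - (a, a) / 2 f\<close>, so the character is trivial for \<open>v\<close> and \<open>a - (a, a) / 2 f\<close>.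
\<close>

lemma phi_plane_complement:
  assumes "bform S e e = 0" "bform S f f = 0" "bform S e f = 1"
    and v: "bform S v v = 0" "bform S v e = 0" "bform S v f = 0"
    and a: "bform S v a = 0" "bform S e a = 0" "bform S f a = 0"
  shows "\<phi> v a = \<phi> v f powi (bform S a a div 2)"
proof -
  let ?q = "bform S a a div 2" and ?g = "transvection f a"
  have comm: "bform S f v = 0" "bform S a v = 0" "bform S a e = 0" "bform S f e = 1"
    using assms by (simp_all add: bform_commute)
  have g: "?g \<in> SO_tilde_plus S" using assms by (intro transvection_in_SO_tilde_plus)
  have "?g *v v = v" "?g *v e = e + a + (- ?q) *s f"
    by (simp_all add: transvection_mult comm vector_smult_lneg)
  then have "\<phi> v e = \<phi> v (e + a + (- ?q) *s f)"
    using phi_equivariant[OF g v(1,2)] by simp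
  also have "\<dots> = \<phi> v e * \<phi> v a * \<phi> v f powi (- ?q)"
    using assms by (simp add: phi_add phi_scale bform_simps del: vector_smult_lneg)
  finally have "\<phi> v a * \<phi> v f powi (- ?q) = 1"
    using phi_nonzero[OF v(1,2)] by simp
  then show ?thesis
    using phi_nonzero[OF v(1,3)] by (simp add: power_int_minus field_simps)
qed

text \<open>Polarisation: on the complement of the planes \<open>\<phi> e\<close> is additive, but
  by \<open>phi_plane_complement\<close> it is \<open>\<phi> e f'\<close> to the power of the half
  norm. The half norm of b + c exceeds the sum of the half norms by (b, c).\<close>

lemma phi_plane_power:
  assumes pp: "plane_pair S e f e' f'"
    and b: "\<forall>u\<in>{e, f, e', f'}. bform S u b = 0 \<and> bform S u c = 0"
  shows "\<phi> e f' powi bform S b c = 1"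
proof -
  note pb = plane_pair_bform[OF pp]
  have *: "\<phi> e a = \<phi> e f' powi (bform S a a div 2)" if "\<forall>u\<in>{e, f, e', f'}. bform S u a = 0" for a
    using that by (intro phi_plane_complement[of e' f']) (auto simp: pb)
  have nz: "\<phi> e f' \<noteq> 0" "\<phi> e b \<noteq> 0" "\<phi> e c \<noteq> 0"
    using b phi_nonzero[of e f'] phi_nonzero[of e b] phi_nonzero[of e c] by (auto simp: pb)
  have "\<forall>u\<in>{e, f, e', f'}. bform S u (b + c) = 0" using b by (auto simp: bform_simps)
  then have "\<phi> e (b + c) = \<phi> e f' powi (bform S b b div 2 + bform S c c div 2 + bform S b c)"
    by (simp only: * half_norm_add)
  also have "\<dots> = \<phi> e b * \<phi> e c * \<phi> e f' powi (bform S b c)"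
    using nz(1) b by (simp add: power_int_add *)
  finally show ?thesis
    using nz phi_add[of e b c] b by (simp add: pb)
qed

text \<open>
  The transvections along \<open>e, f'\<close> and \<open>f, e'\<close> generate a copy of \<open>SL\<^sub>2(\<int>)\<close>, in which the order of
  the elementary matrices modulo commutators is 12.
\<close>

lemma phi_plane_order:
  assumes pp: "plane_pair S e f e' f'"
  shows "\<phi> e f' ^ 12 = 1"
proof -
  note pb = plane_pair_bform[OF pp]
  let ?T = "transvection e f'" and ?W = "transvection f e'"
  \<comment> \<open>The Weyl element of the \<open>SL_2\<close>: its square is -1 on the two planes
    and 1 on their complement, so its fourth power is 1.\<close>
  let ?s = "?T ** (?W ** ?T)"
  have T: "?T \<in> SO_tilde_plus S" and W: "?W \<in> SO_tilde_plus S"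
    by (auto intro!: transvection_in_SO_tilde_plus simp: pb)
  then have s: "?s \<in> SO_tilde_plus S"
    by (intro SO_tilde_plus_mult)
  have s_mult: "?s *v x = x - (bform S f x + bform S f' x) *s e - (bform S e x + bform S e' x) *s f
      + (bform S f x - bform S f' x) *s e' + (bform S e x - bform S e' x) *s f'" for x
    by (simp flip: matrix_vector_mul_assoc
        add: transvection_mult bform_simps pb vec_eq_iff algebra_simps)
  have s2_mult: "(?s ** ?s) *v x = x - (2 * bform S f x) *s e - (2 * bform S e x) *s f
      - (2 * bform S f' x) *s e' - (2 * bform S e' x) *s f'" for x
    unfolding matrix_vector_mul_assoc[symmetric, of ?s] s_mult
    by (simp add: bform_simps pb vec_eq_iff algebra_simps)
  have "((?s ** ?s) ** (?s ** ?s)) *v x = x" for x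
    unfolding matrix_vector_mul_assoc[symmetric, of "?s ** ?s"] s2_mult
    by (simp add: bform_simps pb vec_eq_iff algebra_simps)
  then have s4: "(?s ** ?s) ** (?s ** ?s) = mat 1"
    by (simp add: matrix_eq)
  \<comment> \<open>Hence t(e, f') is conjugate to t(e', -f), which is t(f, e'). Both factors
    \<open>?T\<close> and \<open>?W\<close> have the same character value x, so \<open>?s\<close>
    has value x^3 and x^12 = 1.\<close>
  have "?s *v e = e'" "?s *v f' = - f"
    unfolding s_mult by (simp_all add: pb vec_eq_iff)
  then have "\<phi> e' (- f) = \<phi> e f'"
    using phi_equivariant[OF s, of e f'] by (simp add: pb)
  then have "\<phi> f e' = \<phi> e f'"
    using phi_swap[of f e'] by (simp add: pb)
  then have "\<xi> ?s = \<phi> e f' ^ 3"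
    using T W by (simp add: char_mult SO_tilde_plus_mult \<phi>_def power3_eq_cube)
  moreover have "\<xi> (mat 1) = 1"
    using phi_zero[of e] by (simp add: \<phi>_def transvection_def pb)
  ultimately show ?thesis
    using s s4 char_mult[of "?s ** ?s" "?s ** ?s"] char_mult[OF s s]
    by (simp add: SO_tilde_plus_mult eval_nat_numeral mult_ac)
qed

lemma phi_cross_planes:
  assumes pp: "plane_pair S e f e' f'"
  shows "\<phi> e f' = 1"
proof -
  let ?x = "\<phi> e f'"
  have nz: "?x \<noteq> 0" by (intro phi_nonzero) (simp_all add: plane_pair_bform[OF pp])
  obtain b c :: "int^'n" where bc: "\<forall>u\<in>{e, f, e', f'}. bform S u b = 0 \<and> bform S u c = 0"
      "\<not> 2 dvd bform S b c"
    using rank_mod_complement[OF pp, of 2] rank2 by auto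
  obtain b' c' :: "int^'n" where bc': "\<forall>u\<in>{e, f, e', f'}. bform S u b' = 0 \<and> bform S u c' = 0"
      "\<not> 3 dvd bform S b' c'"
    using rank_mod_complement[OF pp, of 3] rank3 by auto
  \<comment> \<open>The cube of x^4 is 1, and an exponent prime to 3 kills x^4; an odd exponent then
    kills x.\<close>
  have "?x ^ 4 = 1"
  proof (rule power_int_eq_1_three)
    show "(?x ^ 4) ^ 3 = 1" using phi_plane_order[OF pp] by (simp flip: power_mult)
    have "(?x ^ 4) powi bform S b' c' = (?x powi bform S b' c') ^ 4"
      by (simp add: power_int_power power_int_power' mult.commute)
    then show "(?x ^ 4) powi bform S b' c' = 1" using phi_plane_power[OF pp bc'(1)] by simp
  qed (use bc' nz in auto)
  then show ?thesis
    using power_int_eq_1_four[OF _ phi_plane_power[OF pp bc(1)]] bc(2) nz by simp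
qed

text \<open>The complement of e is generated by e, e', f' and vectors orthogonal to both planes, and
  the homomorphism \<open>\<phi> e\<close> is trivial on each of these.\<close>

lemma phi_isotropic_plane_vector:
  assumes pp: "plane_pair S e f e' f'" and a: "bform S e a = 0"
  shows "\<phi> e a = 1"
proof -
  note pb = plane_pair_bform[OF pp]
  obtain y where y: "a = bform S f a *s e + bform S e a *s f + bform S f' a *s e'
      + bform S e' a *s f' + y"
    "bform S e y = 0" "bform S f y = 0" "bform S e' y = 0" "bform S f' y = 0"
    by (rule plane_pair_complement[OF pp, of a])
  have "\<phi> e y = \<phi> e f' powi (bform S y y div 2)"
    using y(2-5) by (intro phi_plane_complement[of e' f']) (auto simp: pb)
  then have phi_y: "\<phi> e y = 1" by (simp add: phi_cross_planes[OF pp])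
  have phi_e': "\<phi> e e' = 1" by (rule phi_cross_planes[OF plane_pair_flip'[OF pp]])
  have "transvection e e = mat 1"
    by (simp add: matrix_eq transvection_mult pb)
  then have phi_e: "\<phi> e e = 1"
    using phi_zero[of e] by (simp add: \<phi>_def transvection_def pb)
  have "a = bform S f a *s e + bform S f' a *s e' + bform S e' a *s f' + y"
    using y(1) a by simp
  then have "\<phi> e a = \<phi> e (bform S f a *s e + bform S f' a *s e' + bform S e' a *s f' + y)"
    by simp
  also have "\<dots> = 1"
    by (simp add: phi_add phi_scale bform_simps pb y(2-5) phi_y phi_e phi_e' phi_cross_planes[OF pp])
  finally show ?thesis .
qed

text \<open>Exchanging the two vectors reduces the values at e and f to transvections along e and f,
  which are already known. The rest of a is orthogonal to the plane, where \<open>\<phi> v\<close>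
  is a power of its value at f.\<close>

lemma phi_orthogonal_to_plane:
  assumes pp: "plane_pair S e f e' f'"
    and v: "bform S v v = 0" "bform S v a = 0" "bform S e v = 0" "bform S f v = 0"
  shows "\<phi> v a = 1"
proof -
  note pb = plane_pair_bform[OF pp]
  define b where "b = a - bform S f a *s e - bform S e a *s f"
  have comm: "bform S v e = 0" "bform S v f = 0" using v by (simp_all add: bform_commute)
  have phi_e: "\<phi> v e = 1"
    using phi_swap[of v e] phi_isotropic_plane_vector[OF pp, of "- v"] v
    by (simp add: pb bform_simps)
  have phi_f: "\<phi> v f = 1"
    using phi_swap[of v f] phi_isotropic_plane_vector[OF plane_pair_flip[OF pp], of "- v"] v
    by (simp add: pb bform_simps)
  have b: "bform S v b = 0" "bform S e b = 0" "bform S f b = 0"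
    using v comm by (simp_all add: b_def bform_simps pb)
  have "\<phi> v b = \<phi> v f powi (bform S b b div 2)"
    using b v comm by (intro phi_plane_complement[of e f]) (auto simp: pb)
  then have phi_b: "\<phi> v b = 1" by (simp add: phi_f)
  have "\<phi> v a = \<phi> v (bform S f a *s e + bform S e a *s f + b)"
    by (simp add: b_def)
  also have "\<dots> = 1"
    using v b comm by (simp add: phi_add phi_scale bform_simps phi_e phi_f phi_b)
  finally show ?thesis .
qed

section \<open>Reduction of an arbitrary isotropic vector\<close>

lemma phi_transvection_conj:
  assumes "bform S u u = 0" "bform S u w = 0" "bform S v v = 0" "bform S v a = 0"
    and "\<phi> (transvection u w *v v) (transvection u w *v a) = 1"
  shows "\<phi> v a = 1"
  using assms phi_equivariant[OF transvection_in_SO_tilde_plus, of u w v a] by simp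

text \<open>A Euclidean algorithm on the coordinates in the two planes.\<close>

lemma phi_descent:
  assumes pp: "plane_pair S e f e' f'"
    and v: "bform S v v = 0" "bform S v a = 0" "bform S e v \<noteq> 0"
  shows "\<phi> v a = 1"
  using v
proof (induction "nat \<bar>bform S e v\<bar>" arbitrary: v a rule: less_induct)
  case less
  note pb = plane_pair_bform[OF pp]
  let ?p = "bform S e v"
  \<comment> \<open>This transvection fixes e, hence keeps (e, v), and adds a multiple of it to (f',
    v), leaving the remainder.\<close>
  let ?g = "transvection e ((- (bform S f' v div ?p)) *s e')"
  define v1 a1 where "v1 = ?g *v v" and "a1 = ?g *v a"
  have g: "?g \<in> SO_tilde_plus S" by (intro transvection_in_SO_tilde_plus) (simp_all add: bform_simps pb)
  have v1: "bform S v1 v1 = 0" "bform S v1 a1 = 0" "bform S e v1 = ?p"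
      "bform S f' v1 = bform S f' v mod ?p"
    using less.prems
    by (simp_all add: v1_def a1_def SO_tilde_plus_bform[OF g])
      (simp_all add: transvection_mult bform_simps pb minus_mult_div_eq_mod)
  have "\<phi> v1 a1 = 1"
  proof (cases "bform S f' v mod ?p = 0")
    case False
    \<comment> \<open>Subtracts the pairing with f' from the pairing with e, so a nonzero remainder
      makes the latter smaller in absolute value but still nonzero.\<close>
    let ?h = "transvection f f'"
    have h: "?h \<in> SO_tilde_plus S" by (intro transvection_in_SO_tilde_plus) (simp_all add: pb)
    have "bform S e (?h *v v1) = ?p - bform S f' v mod ?p"
      using v1 by (simp add: transvection_mult bform_simps pb)
    then have "\<phi> (?h *v v1) (?h *v a1) = 1"
      using abs_diff_mod_less[OF less.prems(3) False] v1
      by (intro less.hyps) (simp_all add: SO_tilde_plus_bform[OF h])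
    then show ?thesis
      by (rule phi_transvection_conj[of f f', rotated 4]) (use v1 in \<open>simp_all add: pb\<close>)
  next
    case f'0: True
    let ?h = "transvection e ((- (bform S e' v1 div ?p)) *s f')"
    define v2 a2 where "v2 = ?h *v v1" and "a2 = ?h *v a1"
    have h: "?h \<in> SO_tilde_plus S" by (intro transvection_in_SO_tilde_plus) (simp_all add: bform_simps pb)
    have v2: "bform S v2 v2 = 0" "bform S v2 a2 = 0" "bform S e v2 = ?p"
        "bform S f' v2 = 0" "bform S e' v2 = bform S e' v1 mod ?p"
      using v1 f'0
      by (simp_all add: v2_def a2_def SO_tilde_plus_bform[OF h])
        (simp_all add: transvection_mult bform_simps pb minus_mult_div_eq_mod)
    have "\<phi> v2 a2 = 1"
    proof (cases "bform S e' v1 mod ?p = 0")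
      case False
      let ?k = "transvection f e'"
      have k: "?k \<in> SO_tilde_plus S" by (intro transvection_in_SO_tilde_plus) (simp_all add: pb)
      have "bform S e (?k *v v2) = ?p - bform S e' v1 mod ?p"
        using v2 by (simp add: transvection_mult bform_simps pb)
      then have "\<phi> (?k *v v2) (?k *v a2) = 1"
        using abs_diff_mod_less[OF less.prems(3) False] v2
        by (intro less.hyps) (simp_all add: SO_tilde_plus_bform[OF k])
      then show ?thesis
        by (rule phi_transvection_conj[of f e', rotated 4]) (use v2 in \<open>simp_all add: pb\<close>)
    next
      case True
      \<comment> \<open>Both remainders vanish, so the vector is orthogonal to the plane of e' and
        f'.\<close>
      then show ?thesis
        using v2 phi_orthogonal_to_plane[OF plane_pair_swap[OF pp]] by simp
    qed
    then show ?thesis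
      unfolding v2_def a2_def
      by (rule phi_transvection_conj[of e "(- (bform S e' v1 div ?p)) *s f'", rotated 4])
        (use v1 in \<open>simp_all add: pb bform_simps\<close>)
  qed
  then show ?case
    unfolding v1_def a1_def
    by (rule phi_transvection_conj[of e "(- (bform S f' v div ?p)) *s e'", rotated 4])
      (use less.prems in \<open>simp_all add: pb bform_simps\<close>)
qed

theorem character_transvection:
  assumes v: "bform S v v = 0" "bform S v a = 0"
  shows "\<xi> (transvection v a) = 1"
proof -
  obtain e f e' f' where pp: "plane_pair S e f e' f'" using two_planes by blast
  consider "bform S e' v \<noteq> 0" | "bform S f' v \<noteq> 0" | "bform S e' v = 0" "bform S f' v = 0"
    by blast
  then have "\<phi> v a = 1"
  proof cases
    case 1
    then show ?thesis using phi_descent[OF plane_pair_swap[OF pp] v] by blast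
  next
    case 2
    then show ?thesis
      using phi_descent[OF plane_pair_flip[OF plane_pair_swap[OF pp]] v] by blast
  next
    case 3
    then show ?thesis using phi_orthogonal_to_plane[OF plane_pair_swap[OF pp] v] by blast
  qed
  then show ?thesis by (simp add: \<phi>_def)
qed

end

section \<open>Forms of signature \<open>(2, n)\<close>\<close>

locale signature_form = symmetric_form S for S :: "int^'n^'n" +
  fixes n :: nat
  assumes signature: "has_signature S 2 n"
begin

lemma orthogonal_basis:
  obtains b :: "'n \<Rightarrow> real^'n" where
    "\<forall>i j. i \<noteq> j \<longrightarrow> bform S (b i) (b j) = 0"
    "\<forall>i. bform S (b i) (b i) \<noteq> 0"
    "card {i. bform S (b i) (b i) > 0} = 2"
    "\<forall>x. \<exists>c. x = (\<Sum>i\<in>UNIV. c i *s b i)"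
proof -
  obtain b :: "'n \<Rightarrow> real^'n" where b: "inj b" "independent (range b)"
      "\<forall>i j. i \<noteq> j \<longrightarrow> bform S (b i) (b j) = 0"
      "card {i. bform S (b i) (b i) > 0} = 2" "card {i. bform S (b i) (b i) < 0} = n"
      "CARD('n) = 2 + n"
    using signature unfolding has_signature_def by (elim exE conjE) (rule that)
  \<comment> \<open>The positive and negative indices already exhaust the rank, so no basis vector
    is isotropic.\<close>
  have "card ({i. bform S (b i) (b i) > 0} \<union> {i. bform S (b i) (b i) < 0}) = CARD('n)"
    using b(4-6) by (subst card_Un_disjoint) (simp_all add: disjoint_iff)
  then have "{i. bform S (b i) (b i) > 0} \<union> {i. bform S (b i) (b i) < 0} = UNIV"
    by (rule card_subset_eq[OF finite subset_UNIV])
  then have "i \<in> {i. bform S (b i) (b i) > 0} \<union> {i. bform S (b i) (b i) < 0}" for i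
    by simp
  then have nz: "bform S (b i) (b i) \<noteq> 0" for i
    by (metis (mono_tags, lifting) Un_iff less_irrefl mem_Collect_eq)
  have "card (range b) = CARD('n)" using b(1) by (simp add: card_image)
  then have "UNIV \<subseteq> span (range b)"
    by (intro card_ge_dim_independent[OF subset_UNIV b(2)]) simp
  then have "\<exists>c. x = (\<Sum>i\<in>UNIV. c i *s b i)" for x
  proof -
    have "x \<in> span (range b)" using \<open>UNIV \<subseteq> span (range b)\<close> by blast
    then obtain u where "x = (\<Sum>v\<in>range b. u v *\<^sub>R v)"
      using span_finite[of "range b"] by auto
    also have "\<dots> = (\<Sum>i\<in>UNIV. u (b i) *s b i)"
      using b(1) by (simp add: sum.reindex scalar_mult_eq_scaleR)
    finally show ?thesis by (intro exI[of _ "\<lambda>i. u (b i)"])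
  qed
  then show thesis using b(3,4) nz that[of b] by simp
qed

lemma nondegenerate:
  fixes x :: "real^'n"
  assumes "\<And>y. bform S x y = 0"
  shows "x = 0"
proof -
  obtain b :: "'n \<Rightarrow> real^'n" where b: "\<forall>i j. i \<noteq> j \<longrightarrow> bform S (b i) (b j) = 0"
      "\<forall>i. bform S (b i) (b i) \<noteq> 0" "card {i. bform S (b i) (b i) > 0} = 2"
      "\<forall>x. \<exists>c. x = (\<Sum>i\<in>UNIV. c i *s b i)"
    by (rule orthogonal_basis)
  obtain c where c: "x = (\<Sum>i\<in>UNIV. c i *s b i)" using b(4) by blast
  have "c j = 0" for j
  proof -
    have "bform S x (b j) = (\<Sum>i\<in>UNIV. if i = j then c j * bform S (b j) (b j) else 0)"
      unfolding c bform_sum_left by (intro sum.cong) (auto simp: bform_simps b(1))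
    then show ?thesis using assms[of "b j"] spec[OF b(2), of j] by simp
  qed
  then show ?thesis using c by simp
qed

text \<open>Some combination is orthogonal to a positive definite plane, hence negative unless zero.\<close>

lemma semidefinite_dependent:
  fixes u1 u2 u3 :: "real^'n"
  assumes "bform S u1 u1 \<ge> 0" "bform S u2 u2 \<ge> 0" "bform S u3 u3 \<ge> 0"
    and "bform S u1 u2 = 0" "bform S u1 u3 = 0" "bform S u2 u3 = 0"
  shows "\<exists>\<alpha> \<beta> \<gamma>. (\<alpha> \<noteq> 0 \<or> \<beta> \<noteq> 0 \<or> \<gamma> \<noteq> 0) \<and> \<alpha> *s u1 + \<beta> *s u2 + \<gamma> *s u3 = 0"
proof -
  obtain b :: "'n \<Rightarrow> real^'n" where b: "\<forall>i j. i \<noteq> j \<longrightarrow> bform S (b i) (b j) = 0"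
      "\<forall>i. bform S (b i) (b i) \<noteq> 0" "card {i. bform S (b i) (b i) > 0} = 2"
      "\<forall>x. \<exists>c. x = (\<Sum>i\<in>UNIV. c i *s b i)"
    by (rule orthogonal_basis)
  let ?P = "{i. bform S (b i) (b i) > 0}" and ?u = "\<lambda>i::nat. [u1, u2, u3] ! i"
  \<comment> \<open>Three unknowns against two equations, one for each positive basis
    vector.\<close>
  obtain c where c: "\<exists>i\<in>{..<3}. c i \<noteq> 0" "\<forall>k\<in>?P. (\<Sum>i<3. c i * bform S (b k) (?u i)) = 0"
    using nontrivial_solution[of ?P "{..<3}" "\<lambda>k i. bform S (b k) (?u i)"] b(3) by auto
  define z where "z = c 0 *s u1 + c 1 *s u2 + c 2 *s u3"
  have orth: "bform S (b k) z = 0" if "k \<in> ?P" for k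
    using bspec[OF c(2) that] by (simp add: z_def bform_simps eval_nat_numeral add.assoc)
  have "bform S u2 u1 = 0" "bform S u3 u1 = 0" "bform S u3 u2 = 0"
    using assms by (simp_all add: bform_commute)
  then have "bform S z z = (c 0)\<^sup>2 * bform S u1 u1 + (c 1)\<^sup>2 * bform S u2 u2 + (c 2)\<^sup>2 * bform S u3 u3"
    using assms by (simp add: z_def bform_simps power2_eq_square)
  then have z_nonneg: "bform S z z \<ge> 0" using assms(1-3) by simp
  obtain d where d: "z = (\<Sum>i\<in>UNIV. d i *s b i)" using b(4) by blast
  have bz: "bform S (b j) z = d j * bform S (b j) (b j)" for j
  proof -
    have "bform S (b j) z = (\<Sum>i\<in>UNIV. if i = j then d j * bform S (b j) (b j) else 0)"
      unfolding d bform_sum_right by (intro sum.cong) (auto simp: bform_simps b(1))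
    then show ?thesis by simp
  qed
  have "bform S z z = (\<Sum>i\<in>UNIV. d i * bform S (b i) z)"
    by (subst d) (simp add: bform_sum_left bform_simps)
  also have "\<dots> = (\<Sum>i\<in>UNIV. (d i)\<^sup>2 * bform S (b i) (b i))"
    by (simp add: bz power2_eq_square mult.assoc)
  finally have zz: "(\<Sum>i\<in>UNIV. - ((d i)\<^sup>2 * bform S (b i) (b i))) \<le> 0"
    using z_nonneg by (simp add: sum_negf)
  have terms: "- ((d i)\<^sup>2 * bform S (b i) (b i)) \<ge> 0" for i
  proof (cases "i \<in> ?P")
    case True
    then show ?thesis using orth bz by simp
  next
    case False
    then show ?thesis by (simp add: mult_nonneg_nonpos)
  qed
  have "(\<Sum>i\<in>UNIV. - ((d i)\<^sup>2 * bform S (b i) (b i))) = 0"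
    using zz terms by (intro antisym sum_nonneg) auto
  then have "\<forall>i\<in>UNIV. - ((d i)\<^sup>2 * bform S (b i) (b i)) = 0"
    by (subst (asm) sum_nonneg_eq_0_iff) (use terms in auto)
  then have "d i = 0" for i using spec[OF b(2), of i] by auto
  then have "z = 0" using d by simp
  moreover have "c 0 \<noteq> 0 \<or> c 1 \<noteq> 0 \<or> c 2 \<noteq> 0"
    using c(1) by (auto simp: less_Suc_eq eval_nat_numeral)
  ultimately show ?thesis unfolding z_def by blast
qed

lemma orthogonal_to_positive_plane:
  fixes u X Y :: "real^'n"
  assumes "bform S X X > 0" "bform S Y Y > 0" "bform S X Y = 0"
    and "bform S u X = 0" "bform S u Y = 0" "bform S u u \<ge> 0"
  shows "u = 0"
proof -
  obtain \<alpha> \<beta> \<gamma> where *: "\<alpha> \<noteq> 0 \<or> \<beta> \<noteq> 0 \<or> \<gamma> \<noteq> 0" "\<alpha> *s X + \<beta> *s Y + \<gamma> *s u = 0"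
    using semidefinite_dependent[of X Y u] assms by (auto simp: bform_commute)
  have "bform S (\<alpha> *s X + \<beta> *s Y + \<gamma> *s u) X = 0" "bform S (\<alpha> *s X + \<beta> *s Y + \<gamma> *s u) Y = 0"
    by (simp_all only: * bform_zero_left)
  then have "\<alpha> = 0" "\<beta> = 0" using assms by (simp_all add: bform_simps bform_commute[of Y X])
  then show ?thesis using * by auto
qed

end

section \<open>Nilpotent logarithms of isometries\<close>

lemma mat_power_mult_vec: "mat_power A k *v x = ((*v) A ^^ k) x"
  by (induction k) (simp_all add: mat_power_def flip: matrix_vector_mul_assoc)

lemma nilpotent_mat_iff: "nilpotent_mat A \<longleftrightarrow> (\<exists>k. \<forall>x. ((*v) A ^^ k) x = 0)"
  by (simp add: nilpotent_mat_def matrix_eq flip: mat_power_mult_vec)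

lemma funpow_matrix_zero [simp]: "((*v) (A :: 'a::comm_ring_1^'n^'n) ^^ k) 0 = 0"
  by (induction k) simp_all

lemma funpow_eq_0_mono:
  fixes A :: "'a::comm_ring_1^'n^'n"
  assumes "\<And>x. ((*v) A ^^ k) x = 0" "k \<le> l"
  shows "((*v) A ^^ l) x = 0"
  using assms funpow_add[of "l - k" k "(*v) A"] by simp

lemma mat_exp_nilpotent:
  fixes A :: "'a::real_normed_field^'n^'n"
  assumes "\<And>x. ((*v) A ^^ K) x = 0"
  shows "mat_exp A *v x = (\<Sum>k<K. (1 / fact k) *s ((*v) A ^^ k) x)"
proof -
  have zero: "mat_power A k = 0" if "k \<ge> K" for k
    using funpow_eq_0_mono[OF assms that] by (simp add: matrix_eq mat_power_mult_vec)
  have "mat_exp A = (\<Sum>k<K. (1 / fact k) *\<^sub>R mat_power A k)"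
    unfolding mat_exp_def by (rule suminf_finite) (auto simp: zero not_less)
  moreover have "(\<Sum>k<m. (1 / fact k) *\<^sub>R mat_power A k) *v x
      = (\<Sum>k<m. (1 / fact k) *s (mat_power A k *v x))" for m
  proof (induction m)
    case (Suc m)
    have "((1 / fact m) *\<^sub>R mat_power A m) *v x = (1 / fact m) *s (mat_power A m *v x)"
      by (simp add: vec_eq_iff matrix_vector_mult_def scaleR_conv_of_real[where 'a='a]
          sum_distrib_left mult_ac)
    then show ?case using Suc by (simp add: matrix_vector_mult_add_rdistrib)
  qed simp
  ultimately show ?thesis by (simp add: mat_power_mult_vec)
qed

text \<open>The derivation by which F acts on bilinear forms. For F = N, pulling a form back along
  exp(N) is the exponential of this derivation.\<close>

definition inf_action ::
  "(real^'n \<Rightarrow> real^'n) \<Rightarrow> (real^'n \<Rightarrow> real^'n \<Rightarrow> real) \<Rightarrow> real^'n \<Rightarrow> real^'n \<Rightarrow> real" where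
  "inf_action F \<beta> x y = \<beta> (F x) y + \<beta> x (F y)"

lemma inf_action_funpow:
  "(inf_action F ^^ k) \<beta> x y =
     (\<Sum>i\<le>k. of_nat (k choose i) * \<beta> ((F ^^ i) x) ((F ^^ (k - i)) y))"
proof (induction k arbitrary: x y)
  case (Suc k)
  let ?b = "\<lambda>i j. \<beta> ((F ^^ i) x) ((F ^^ j) y)"
  have "(inf_action F ^^ Suc k) \<beta> x y
      = (\<Sum>i\<le>k. of_nat (k choose i) * ?b (Suc i) (k - i)) + (\<Sum>i\<le>k. of_nat (k choose i) * ?b i (Suc k - i))"
    by (auto simp: inf_action_def Suc.IH Suc_diff_le simp flip: funpow_swap1 intro!: sum.cong)
  also have "(\<Sum>i\<le>k. of_nat (k choose i) * ?b i (Suc k - i))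
      = ?b 0 (Suc k) + (\<Sum>i\<le>k. of_nat (k choose Suc i) * ?b (Suc i) (k - i))"
  proof -
    have "(\<Sum>i\<le>k. of_nat (k choose i) * ?b i (Suc k - i))
        = (\<Sum>i\<le>Suc k. of_nat (k choose i) * ?b i (Suc k - i))"
      by simp
    also have "\<dots> = ?b 0 (Suc k) + (\<Sum>i\<le>k. of_nat (k choose Suc i) * ?b (Suc i) (k - i))"
      by (subst sum.atMost_Suc_shift) simp
    finally show ?thesis .
  qed
  also have "(\<Sum>i\<le>k. of_nat (k choose i) * ?b (Suc i) (k - i))
      + (?b 0 (Suc k) + (\<Sum>i\<le>k. of_nat (k choose Suc i) * ?b (Suc i) (k - i)))
      = ?b 0 (Suc k) + (\<Sum>i\<le>k. of_nat (Suc k choose Suc i) * ?b (Suc i) (k - i))"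
    by (simp add: sum.distrib algebra_simps)
  also have "\<dots> = (\<Sum>i\<le>Suc k. of_nat (Suc k choose i) * ?b i (Suc k - i))"
    by (subst sum.atMost_Suc_shift) simp
  finally show ?case .
qed simp

lemma inf_action_sum:
  "(inf_action F ^^ j) (\<lambda>x y. \<Sum>k\<in>A. c k * \<beta> k x y)
     = (\<lambda>x y. \<Sum>k\<in>A. c k * (inf_action F ^^ j) (\<beta> k) x y)"
  by (induction j) (simp_all add: inf_action_def fun_eq_iff sum.distrib algebra_simps)

text \<open>A form fixed by the exponential of a nilpotent derivation D is killed by D. If m > 1
  were the least exponent with D^m = 0 on the form, applying D^(m - 2) to the vanishing sum would
  leave only the term D^(m - 1).\<close>

lemma nilpotent_exp_fixed:
  assumes nil: "(inf_action F ^^ M) \<beta> = (\<lambda>x y. 0)"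
    and fixed: "\<And>x y. (\<Sum>k\<in>{1..M}. 1 / fact k * (inf_action F ^^ k) \<beta> x y) = 0"
  shows "inf_action F \<beta> = (\<lambda>x y. 0)"
proof -
  have zero: "(inf_action F ^^ j) (\<lambda>x y. 0) = (\<lambda>x y. 0)" for j
    by (induction j) (simp_all add: inf_action_def fun_eq_iff)
  define m where "m = (LEAST m. (inf_action F ^^ m) \<beta> = (\<lambda>x y. 0))"
  have m: "(inf_action F ^^ m) \<beta> = (\<lambda>x y. 0)" unfolding m_def by (rule LeastI[where P = "\<lambda>m. (inf_action F ^^ m) \<beta> = (\<lambda>x y. 0)", OF nil])
  have m_less: "(inf_action F ^^ k) \<beta> \<noteq> (\<lambda>x y. 0)" if "k < m" for k
    using that not_less_Least unfolding m_def by blast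
  have m_ge: "(inf_action F ^^ k) \<beta> = (\<lambda>x y. 0)" if "k \<ge> m" for k
    using zero[of "k - m"] m that funpow_add[of "k - m" m "inf_action F"] by simp
  have "m \<le> 1"
  proof (rule ccontr)
    assume "\<not> m \<le> 1"
    have "m \<le> M" using m_less nil by (meson not_le)
    have "(inf_action F ^^ (m - 2)) (\<lambda>x y. \<Sum>k\<in>{1..M}. 1 / fact k * (inf_action F ^^ k) \<beta> x y)
        = (\<lambda>x y. \<Sum>k\<in>{1..M}. 1 / fact k * (inf_action F ^^ (m - 2 + k)) \<beta> x y)"
      by (simp only: inf_action_sum funpow_add o_apply)
    also have "\<dots> = (\<lambda>x y. \<Sum>k\<in>{1..M}. if k = 1 then (inf_action F ^^ (m - 1)) \<beta> x y else 0)"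
    proof (intro ext sum.cong refl)
      fix x y k assume "k \<in> {1..M}"
      then show "1 / fact k * (inf_action F ^^ (m - 2 + k)) \<beta> x y
          = (if k = 1 then (inf_action F ^^ (m - 1)) \<beta> x y else 0)"
        using \<open>\<not> m \<le> 1\<close> m_ge[of "m - 2 + k"] by (auto simp: Suc_diff_Suc numeral_2_eq_2)
    qed
    also have "\<dots> = (inf_action F ^^ (m - 1)) \<beta>"
      using \<open>\<not> m \<le> 1\<close> \<open>m \<le> M\<close> by (simp add: fun_eq_iff)
    finally have "(inf_action F ^^ (m - 1)) \<beta> = (\<lambda>x y. 0)"
      by (simp only: fixed zero)
    then show False using m_less[of "m - 1"] \<open>\<not> m \<le> 1\<close> by simp
  qed
  then show ?thesis using m_ge[of 1] by simp
qed

lemma antisymmetric_log: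
  fixes N r :: "real^'n^'n"
  assumes nil: "nilpotent_mat N" and r: "r = mat_exp N"
    and orth: "\<And>x y. bform S (r *v x) (r *v y) = bform S x y"
  shows "bform S (N *v x) y = - bform S x (N *v y)"
proof -
  obtain K where K: "\<And>x. ((*v) N ^^ K) x = 0" using nil by (auto simp: nilpotent_mat_iff)
  let ?F = "(*v) N" and ?B = "bform S :: real^'n \<Rightarrow> real^'n \<Rightarrow> real"
  have K0: "(?F ^^ i) x = 0" if "i \<ge> K" for i x
    using funpow_eq_0_mono[OF K that] .
  have exp_action: "?B (r *v x) (r *v y) = (\<Sum>k\<le>2 * K. 1 / fact k * (inf_action ?F ^^ k) ?B x y)" for x y
  proof -
    let ?g = "\<lambda>i j. 1 / fact i * (1 / fact j) * ?B ((?F ^^ i) x) ((?F ^^ j) y)"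
    have "?B (r *v x) (r *v y) = (\<Sum>i<K. \<Sum>j<K. ?g i j)"
      unfolding r mat_exp_nilpotent[OF K]
      by (simp add: bform_sum_left bform_sum_right bform_simps sum_divide_distrib)
        (subst sum.swap, rule refl)
    also have "\<dots> = (\<Sum>(i, j)\<in>{..<K} \<times> {..<K}. ?g i j)"
      by (simp add: sum.cartesian_product)
    \<comment> \<open>The square of indices is enlarged to a triangle, where terms can be collected
      by total degree; the added terms contain N^K.\<close>
    also have "\<dots> = (\<Sum>(i, j)\<in>{(i, j). i + j \<le> 2 * K}. ?g i j)"
    proof (rule sum.mono_neutral_left)
      show "finite {(i, j). i + j \<le> 2 * K}"
        by (rule finite_subset[of _ "{..2*K} \<times> {..2*K}"]) auto
      show "\<forall>p\<in>{(i, j). i + j \<le> 2 * K} - {..<K} \<times> {..<K}. (case p of (i, j) \<Rightarrow> ?g i j) = 0"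
      proof
        fix p assume "p \<in> {(i, j). i + j \<le> 2 * K} - {..<K} \<times> {..<K}"
        then obtain i j where "p = (i, j)" "i \<ge> K \<or> j \<ge> K" by force
        then show "(case p of (i, j) \<Rightarrow> ?g i j) = 0" using K0[of i x] K0[of j y] by auto
      qed
    qed auto
    also have "\<dots> = (\<Sum>k\<le>2 * K. \<Sum>i\<le>k. ?g i (k - i))"
      by (rule sum.triangle_reindex_eq)
    also have "\<dots> = (\<Sum>k\<le>2 * K. 1 / fact k * (inf_action ?F ^^ k) ?B x y)"
      unfolding inf_action_funpow sum_distrib_left
      by (intro sum.cong refl) (simp add: binomial_fact field_simps)
    finally show ?thesis .
  qed
  \<comment> \<open>In each binomial term one of the exponents i and 2 K - i is at least K.\<close>
  have nilB: "(inf_action ?F ^^ (2 * K)) ?B = (\<lambda>x y. 0)"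
  proof (intro ext)
    fix x y
    show "(inf_action ?F ^^ (2 * K)) ?B x y = 0"
      unfolding inf_action_funpow
    proof (intro sum.neutral ballI)
      fix i assume "i \<in> {..2 * K}"
      show "real (2 * K choose i) * ?B ((?F ^^ i) x) ((?F ^^ (2 * K - i)) y) = 0"
        using K0[of i x] K0[of "2 * K - i" y] by (cases "i \<ge> K") auto
    qed
  qed
  have "(\<Sum>k\<in>{1..2 * K}. 1 / fact k * (inf_action ?F ^^ k) ?B x y) = 0" for x y
  proof -
    have "{..2 * K} = insert 0 {1..2 * K}" by auto
    then show ?thesis using exp_action[of x y] orth[of x y] by simp
  qed
  then have "inf_action ?F ?B x y = 0"
    using nilpotent_exp_fixed[OF nilB] by simp
  then show ?thesis by (simp add: inf_action_def)
qed

section \<open>Nilpotent endomorphisms satisfying the positivity condition\<close>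

lemma quartic_leading_nonneg:
  fixes c0 c1 c2 c3 c4 :: real
  assumes "\<And>y. y \<ge> 0 \<Longrightarrow> c0 + c1 * y + c2 * y ^ 2 + c3 * y ^ 3 + c4 * y ^ 4 > 0"
  shows "c4 \<ge> 0"
proof (rule ccontr)
  assume "\<not> c4 \<ge> 0"
  then have c4: "c4 < 0" by simp
  define M where "M = \<bar>c0\<bar> + \<bar>c1\<bar> + \<bar>c2\<bar> + \<bar>c3\<bar>"
  \<comment> \<open>With this y, M + c4 y equals c4, which is negative, and y is at least 1, so that
    y^3 bounds the lower powers.\<close>
  define y where "y = 1 + M / (- c4)"
  have M: "M \<ge> 0" by (simp add: M_def)
  have y1: "y \<ge> 1" using M c4 by (simp add: y_def divide_nonneg_nonneg del: divide_minus_right)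
  have pow: "1 \<le> y ^ 3" "y \<le> y ^ 3" "y ^ 2 \<le> y ^ 3"
    using y1 power_increasing[of 0 3 y] power_increasing[of 1 3 y] power_increasing[of 2 3 y] by auto
  have bound: "c * z \<le> \<bar>c\<bar> * y ^ 3" if "0 \<le> z" "z \<le> y ^ 3" for c z
  proof -
    have "c * z \<le> \<bar>c\<bar> * z" using that by (intro mult_right_mono) auto
    also have "\<dots> \<le> \<bar>c\<bar> * y ^ 3" using that by (intro mult_left_mono) auto
    finally show ?thesis .
  qed
  have "c0 * 1 + c1 * y + c2 * y ^ 2 + c3 * y ^ 3 \<le> M * y ^ 3"
    unfolding M_def distrib_right using y1 pow by (intro add_mono bound) auto
  moreover have "M + c4 * y < 0"
    using c4 by (simp add: y_def field_simps)
  then have "(M + c4 * y) * y ^ 3 < 0"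
    using y1 by (intro mult_neg_pos) auto
  then have "M * y ^ 3 + c4 * y ^ 4 < 0"
    by (simp add: algebra_simps eval_nat_numeral)
  ultimately show False using assms[of y] y1 by simp
qed

text \<open>One-variable core of the fact that a null vector of a negative semidefinite form is
  orthogonal to everything; b and c are the pairing with, and the norm of, the second
  vector.\<close>

lemma semidefinite_cross:
  fixes b c :: real
  assumes "\<And>t. 2 * t * b + t\<^sup>2 * c \<le> 0"
  shows "b = 0"
proof -
  define t where "t = b / (1 + \<bar>c\<bar>)"
  have b: "b = t * (1 + \<bar>c\<bar>)" by (simp add: t_def)
  have "t\<^sup>2 * (2 + 2 * \<bar>c\<bar> + c) = 2 * t * b + t\<^sup>2 * c"
    by (simp add: b algebra_simps power2_eq_square)
  also have "\<dots> \<le> 0" by (rule assms)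
  finally have "t\<^sup>2 * (2 + 2 * \<bar>c\<bar> + c) \<le> 0" .
  moreover have "2 + 2 * \<bar>c\<bar> + c > 0" by linarith
  ultimately have "t\<^sup>2 \<le> 0" by (simp add: mult_le_0_iff)
  then show ?thesis using b by simp
qed

lemma scale_dependent:
  fixes u v :: "real^'n"
  assumes "\<alpha> *s u + \<beta> *s v = 0" "\<beta> \<noteq> 0"
  shows "v = (- \<alpha> / \<beta>) *s u"
proof (subst vec_eq_iff, intro allI)
  fix i
  have "\<alpha> * u $ i + \<beta> * v $ i = 0"
    using arg_cong[OF assms(1), of "\<lambda>x. x $ i"] by simp
  then have "\<beta> * v $ i = - \<alpha> * u $ i" by linarith
  then show "v $ i = ((- \<alpha> / \<beta>) *s u) $ i"
    using assms(2) by (simp add: field_simps)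
qed

locale nilpotent_antisymmetric = signature_form S n for S :: "int^'n^'n" and n :: nat +
  fixes N :: "real^'n^'n"
  assumes anti: "bform S (N *v x) y = - bform S x (N *v y)"
    and nilpotent: "nilpotent_mat N"
begin

text \<open>Powers of N as functions. Numerals are kept as exponents, including 1, so that
  \<open>F_F\<close> can be used with plain arithmetic.\<close>

definition F :: "nat \<Rightarrow> real^'n \<Rightarrow> real^'n" where
  "F k x = ((*v) N ^^ k) x"

declare One_nat_def [simp del]

lemma F_0 [simp]: "F 0 x = x"
  by (simp add: F_def)

lemma F_1: "F 1 x = N *v x"
  by (simp add: F_def One_nat_def)

lemma F_F: "F i (F j x) = F (i + j) x"
  by (simp add: F_def funpow_add)

lemma F_2: "F 2 x = N *v (N *v x)"
  using F_F[of 1 1 x] by (simp add: F_1)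

lemma F_zero [simp]: "F k 0 = 0"
  by (simp add: F_def)

lemma F_eq_0_mono: "(\<And>x. F k x = 0) \<Longrightarrow> k \<le> l \<Longrightarrow> F l x = 0"
  unfolding F_def by (rule funpow_eq_0_mono)

lemma F_scale: "F k (c *s x) = c *s F k x"
  unfolding F_def by (induction k) (simp_all add: matrix_vector_mult_scale)

lemma F_add: "F k (x + y) = F k x + F k y"
  unfolding F_def by (induction k) (simp_all add: matrix_vector_right_distrib)

lemma anti_F: "bform S (F i x) (F j y) = (-1) ^ i * bform S x (F (i + j) y)"
proof (induction i arbitrary: j)
  case (Suc i)
  have "F (Suc i) x = N *v F i x" "N *v F j y = F (Suc j) y"
    by (simp_all add: F_def)
  then show ?case by (simp add: anti Suc.IH)
qed simp

lemma F_odd_self: "odd k \<Longrightarrow> bform S x (F k x) = 0"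
  using anti_F[of k x 0 x] bform_commute[of "F k x" x] by simp

section \<open>Restrictions on N from the signature alone\<close>

lemma chain_independent:
  assumes "F 2 w \<noteq> 0" "F 3 w = 0" "\<alpha> *s F 2 w + \<beta> *s F 1 w + \<gamma> *s w = 0"
  shows "\<alpha> = 0 \<and> \<beta> = 0 \<and> \<gamma> = 0"
proof -
  have F4: "F 4 w = 0" using assms(2) F_F[of 1 3 w] by simp
  have "F 2 (\<alpha> *s F 2 w + \<beta> *s F 1 w + \<gamma> *s w) = 0" "F 1 (\<alpha> *s F 2 w + \<beta> *s F 1 w + \<gamma> *s w) = 0"
    by (simp_all only: assms(3) F_zero)
  then have "\<gamma> *s F 2 w = 0" "\<beta> *s F 2 w + \<gamma> *s F 1 w = 0"
    unfolding F_add F_scale F_F using assms(2) F4 by (simp_all)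
  then show ?thesis using assms(1,3) by auto
qed

text \<open>Let m be the least exponent with N^m = 0. If m > 5, the last three vectors of a Jordan
  chain of length m pair to values of N^k with k at least 2 (m - 3), hence at least m. They would
  span a totally isotropic space of dimension 3.\<close>

lemma F_5: "F 5 x = 0"
proof -
  define m where "m = (LEAST m. \<forall>x. F m x = 0)"
  have m: "F m x = 0" for x
    using LeastI_ex[of "\<lambda>m. \<forall>x. F m x = 0"] nilpotent
    unfolding m_def nilpotent_mat_iff F_def by blast
  have "m \<le> 5"
  proof (rule ccontr)
    assume "\<not> m \<le> 5"
    then have "\<not> (\<forall>x. F (m - 1) x = 0)"
      unfolding m_def by (intro not_less_Least) simp
    then obtain x where x: "F (m - 1) x \<noteq> 0" by blast
    have zero: "F k y = 0" if "k \<ge> m" for k y using F_eq_0_mono[OF m that] .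
    let ?w = "F (m - 3) x"
    have "1 + (m - 3) = m - 2" "2 + (m - 3) = m - 1" "3 + (m - 3) = m"
      using \<open>\<not> m \<le> 5\<close> by linarith+
    then have w: "F 1 ?w = F (m - 2) x" "F 2 ?w = F (m - 1) x" "F 3 ?w = 0"
      unfolding F_F by (simp_all only: m)
    have "\<exists>\<alpha> \<beta> \<gamma>. (\<alpha> \<noteq> 0 \<or> \<beta> \<noteq> 0 \<or> \<gamma> \<noteq> 0) \<and> \<alpha> *s F 2 ?w + \<beta> *s F 1 ?w + \<gamma> *s ?w = 0"
      unfolding w using \<open>\<not> m \<le> 5\<close>
      by (intro semidefinite_dependent) (simp_all only: anti_F, simp_all add: zero)
    then show False using chain_independent[of ?w] x w by metis
  qed
  then show ?thesis using F_eq_0_mono[OF m] by blast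
qed

text \<open>Jordan blocks of even size come in pairs for an antisymmetric map. Concretely N^3 x, N^3
  y and N^2 x would be mutually orthogonal null vectors; they are independent because (x, N^3 x) = 0
  while (x, N^3 y) is nonzero.\<close>

lemma F_3_of_F_4:
  assumes "\<And>x. F 4 x = 0"
  shows "F 3 x = 0"
proof (rule ccontr)
  assume x: "F 3 x \<noteq> 0"
  have zero: "F k y = 0" if "k \<ge> 4" for k y using F_eq_0_mono[OF assms that] .
  obtain y where y: "bform S (F 3 x) y \<noteq> 0" using nondegenerate[of "F 3 x"] x by blast
  then have y': "bform S x (F 3 y) \<noteq> 0" using anti_F[of 3 x 0 y] by simp
  obtain \<alpha> \<beta> \<gamma> where *: "\<alpha> \<noteq> 0 \<or> \<beta> \<noteq> 0 \<or> \<gamma> \<noteq> 0"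
      "\<alpha> *s F 3 x + \<beta> *s F 3 y + \<gamma> *s F 2 x = 0"
    using semidefinite_dependent[of "F 3 x" "F 3 y" "F 2 x"]
    by (auto simp only: anti_F) (auto simp: zero)
  have "F 1 (\<alpha> *s F 3 x + \<beta> *s F 3 y + \<gamma> *s F 2 x) = 0" by (simp only: * F_zero)
  then have "\<gamma> *s F 3 x = 0" unfolding F_add F_scale F_F by (simp add: zero)
  then have \<gamma>: "\<gamma> = 0" using x by simp
  have "bform S x (\<alpha> *s F 3 x + \<beta> *s F 3 y) = 0" using * \<gamma> by simp
  then have "\<beta> = 0" using y' F_odd_self[of 3 x] by (simp add: bform_simps)
  then show False using * \<gamma> x by simp
qed

text \<open>The image of N is totally isotropic, hence of dimension at most 2. In a relation between
  N x, N y and N z, pairing with x removes N z if (N x, z) is nonzero.\<close>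

lemma rank_one_on_complement_of_square_zero:
  assumes F2: "\<And>x. F 2 x = 0" and x: "N *v x \<noteq> 0" and y: "bform S (N *v x) y = 0"
  shows "\<exists>c. N *v y = c *s (N *v x)"
proof -
  have iso: "bform S (N *v u) (N *v v) = 0" for u v
    using anti_F[of 1 u 1 v] F2[of v] by (simp add: F_1)
  obtain z where z: "bform S (N *v x) z \<noteq> 0" using nondegenerate[of "N *v x"] x by blast
  obtain \<alpha> \<beta> \<gamma> where *: "\<alpha> \<noteq> 0 \<or> \<beta> \<noteq> 0 \<or> \<gamma> \<noteq> 0"
      "\<alpha> *s (N *v x) + \<beta> *s (N *v y) + \<gamma> *s (N *v z) = 0"
    using semidefinite_dependent[of "N *v x" "N *v y" "N *v z"] unfolding iso by blast
  have self: "bform S (N *v u) u = 0" for u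
    using F_odd_self[of 1 u] by (simp add: F_1 bform_commute)
  have flip: "bform S (N *v u) x = - bform S (N *v x) u" for u
    using anti[of u x] bform_commute[of u "N *v x"] by simp
  have "bform S (N *v y) x = 0" "bform S (N *v z) x \<noteq> 0" using y z by (simp_all add: flip)
  moreover have "bform S (\<alpha> *s (N *v x) + \<beta> *s (N *v y) + \<gamma> *s (N *v z)) x = 0"
    by (simp only: * bform_zero_left)
  ultimately have \<gamma>: "\<gamma> = 0" using self by (simp add: bform_simps)
  have "\<beta> \<noteq> 0" using * \<gamma> x by auto
  have "\<alpha> *s (N *v x) + \<beta> *s (N *v y) = 0" using *(2) \<gamma> by simp
  then have "N *v y = (- \<alpha> / \<beta>) *s (N *v x)"
    using \<open>\<beta> \<noteq> 0\<close> by (rule scale_dependent)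
  then show ?thesis by blast
qed

text \<open>
  The left-hand side below is the hermitian square of \<open>exp(iyN) (X + iY)\<close>; only the shape of its
  coefficients of \<open>y\<^sup>2\<close> and \<open>y\<^sup>4\<close> matters.
\<close>

lemma hermitian_square_exp:
  fixes X Y :: "real^'n" and y :: real
  defines "P \<equiv> X - y *s F 1 Y - (y ^ 2 / 2) *s F 2 X + (y ^ 3 / 6) *s F 3 Y + (y ^ 4 / 24) *s F 4 X"
    and "Q \<equiv> Y + y *s F 1 X - (y ^ 2 / 2) *s F 2 Y - (y ^ 3 / 6) *s F 3 X + (y ^ 4 / 24) *s F 4 Y"
  shows "bform S P P + bform S Q Q =
     (bform S X X + bform S Y Y) + (- 4 * bform S X (F 1 Y)) * y
     + (2 * (bform S (F 1 X) (F 1 X) + bform S (F 1 Y) (F 1 Y))) * y ^ 2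
     + (8 / 3 * bform S X (F 3 Y)) * y ^ 3
     + (2 / 3 * (bform S (F 2 X) (F 2 X) + bform S (F 2 Y) (F 2 Y))) * y ^ 4"
proof -
  have zero: "F k x = 0" if "k \<ge> 5" for k x using F_eq_0_mono[OF F_5 that] .
  have cross: "bform S (F i Y) (F j X) = (-1) ^ j * bform S X (F (i + j) Y)" for i j
    using anti_F[of j X i Y] by (simp add: bform_commute[of "F i Y"] add.commute)
  have cross0: "bform S Y (F j X) = (-1) ^ j * bform S X (F j Y)"
      "bform S (F i Y) X = bform S X (F i Y)"
      "bform S (F j X) Y = (-1) ^ j * bform S X (F j Y)" for i j
    using cross[of 0 j] cross[of i 0] anti_F[of j X 0 Y] by simp_all
  have self: "bform S (F i X) X = (-1) ^ i * bform S X (F i X)"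
     "bform S (F i Y) Y = (-1) ^ i * bform S Y (F i Y)" "bform S Y X = bform S X Y" for i
    using anti_F[of i X 0 X] anti_F[of i Y 0 Y] bform_commute by simp_all
  have odd: "bform S x (F 1 x) = 0" "bform S x (F 3 x) = 0" for x
    using F_odd_self by simp_all
  have "bform S P P + bform S Q Q =
     (bform S X X + bform S Y Y) + (- 4 * bform S X (F 1 Y)) * y
     + (2 * (- bform S X (F 2 X) - bform S Y (F 2 Y))) * y ^ 2
     + (8 / 3 * bform S X (F 3 Y)) * y ^ 3
     + (2 / 3 * (bform S X (F 4 X) + bform S Y (F 4 Y))) * y ^ 4"
    unfolding P_def Q_def
    by (simp only: bform_simps anti_F cross0 self)
      (simp add: zero odd, simp add: field_simps power_numeral_reduce)
  then show ?thesis by (simp add: anti_F)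
qed

end

text \<open>X + iY plays the role of a point of the cone and P + iQ of its image under exp(iyN),
  whose series ends at N^4 by \<open>F_5\<close>. Positivity is required along the imaginary
  half-axis.\<close>

locale positive_nilpotent = nilpotent_antisymmetric S n N
  for S :: "int^'n^'n" and n :: nat and N :: "real^'n^'n" +
  fixes X Y :: "real^'n"
  assumes plane: "bform S X X > 0" "bform S Y Y > 0" "bform S X Y = 0"
    and positive: "y \<ge> 0 \<Longrightarrow>
      (let P = X - y *s F 1 Y - (y ^ 2 / 2) *s F 2 X + (y ^ 3 / 6) *s F 3 Y + (y ^ 4 / 24) *s F 4 X;
           Q = Y + y *s F 1 X - (y ^ 2 / 2) *s F 2 Y - (y ^ 3 / 6) *s F 3 X + (y ^ 4 / 24) *s F 4 Y
       in bform S P P + bform S Q Q > 0)"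
begin

lemma positive_polynomial:
  assumes "y \<ge> 0"
  shows "(bform S X X + bform S Y Y) + (- 4 * bform S X (F 1 Y)) * y
     + (2 * (bform S (F 1 X) (F 1 X) + bform S (F 1 Y) (F 1 Y))) * y ^ 2
     + (8 / 3 * bform S X (F 3 Y)) * y ^ 3
     + (2 / 3 * (bform S (F 2 X) (F 2 X) + bform S (F 2 Y) (F 2 Y))) * y ^ 4 > 0"
  using positive[OF assms] unfolding Let_def hermitian_square_exp .

text \<open>A vector N^(2k) x is null here, so it cannot be orthogonal to the positive plane of X
  and Y unless it is 0; an even power moves across the form without a sign.\<close>

lemma even_power_witness:
  assumes "F (2 * k) x \<noteq> 0" "k > 0" "\<And>z. F (4 * k) z = 0"
  shows "F (2 * k) X \<noteq> 0 \<or> F (2 * k) Y \<noteq> 0"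
proof (rule ccontr)
  assume *: "\<not> ?thesis"
  have "F (2 * k) x = 0"
  proof (rule orthogonal_to_positive_plane[OF plane])
    show "bform S (F (2 * k) x) X = 0" "bform S (F (2 * k) x) Y = 0"
      using anti_F[of "2 * k" x 0 X] anti_F[of "2 * k" x 0 Y] * by simp_all
    show "bform S (F (2 * k) x) (F (2 * k) x) \<ge> 0"
      using anti_F[of "2 * k" x "2 * k" x] assms(3)[of x] by (simp flip: mult_2)
  qed
  then show False using assms by simp
qed

text \<open>If N^4 v is nonzero, N^2 v must have negative norm, for otherwise N^4 v, N^3 v, N^2 v
  contradict the signature. The quartic coefficient forces the norms of N^2 X and N^2 Y to have
  nonnegative sum, so N^4 kills X and Y.\<close>

lemma F_4: "F 4 x = 0"
proof (rule ccontr)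
  assume x: "F 4 x \<noteq> 0"
  have zero: "F k x = 0" if "k \<ge> 5" for k x using F_eq_0_mono[OF F_5 that] .
  have neg: "bform S (F 2 v) (F 2 v) < 0" if v: "F 4 v \<noteq> 0" for v
  proof (rule ccontr)
    assume "\<not> ?thesis"
    then have "\<exists>\<alpha> \<beta> \<gamma>. (\<alpha> \<noteq> 0 \<or> \<beta> \<noteq> 0 \<or> \<gamma> \<noteq> 0) \<and> \<alpha> *s F 4 v + \<beta> *s F 3 v + \<gamma> *s F 2 v = 0"
      by (intro semidefinite_dependent) (simp_all add: anti_F zero)
    moreover have "F 2 (F 2 v) = F 4 v" "F 1 (F 2 v) = F 3 v" "F 3 (F 2 v) = 0"
      unfolding F_F by (simp_all add: zero)
    ultimately show False using chain_independent[of "F 2 v"] v by metis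
  qed
  have nonpos: "bform S (F 2 v) (F 2 v) \<le> 0" for v
    using neg[of v] by (cases "F 4 v = 0") (simp_all add: anti_F)
  have "2 / 3 * (bform S (F 2 X) (F 2 X) + bform S (F 2 Y) (F 2 Y)) \<ge> 0"
    by (rule quartic_leading_nonneg[OF positive_polynomial])
  then have nonneg: "bform S (F 2 X) (F 2 X) + bform S (F 2 Y) (F 2 Y) \<ge> 0" by simp
  have "F 4 X = 0"
    by (rule ccontr, drule neg) (use nonneg nonpos[of Y] in linarith)
  moreover have "F 4 Y = 0"
    by (rule ccontr, drule neg) (use nonneg nonpos[of X] in linarith)
  ultimately show False using even_power_witness[of 2 x] x zero by simp
qed

lemma F_3: "F 3 x = 0"
  using F_3_of_F_4 F_4 by blast

text \<open>Counterpart for nonzero N^2: the image of N^2 is the isotropic line. A vector N x0 of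
  positive norm uses up the remaining positive direction.\<close>

lemma rank_one_on_complement_of_square:
  assumes x: "F 2 x \<noteq> 0" and y: "bform S (F 2 x) y = 0"
  shows "\<exists>c. N *v y = c *s F 2 x"
proof -
  have zero: "F k x = 0" if "k \<ge> 3" for k x using F_eq_0_mono[OF F_3 that] .
  have sum_nonneg: "2 * (bform S (F 1 X) (F 1 X) + bform S (F 1 Y) (F 1 Y)) \<ge> 0"
  proof (rule quartic_leading_nonneg)
    fix t :: real assume t: "t \<ge> 0"
    have quad: "(bform S X X + bform S Y Y) + (- 4 * bform S X (F 1 Y)) * s
        + (2 * (bform S (F 1 X) (F 1 X) + bform S (F 1 Y) (F 1 Y))) * s ^ 2 > 0" if "s \<ge> 0" for s
      using positive_polynomial[OF that] by (simp add: anti_F zero)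
    \<comment> \<open>As N^3 = 0 the polynomial is quadratic; substituting t^2 turns it into a
      quartic with the same leading coefficient.\<close>
    show "(bform S X X + bform S Y Y) + 0 * t + (- 4 * bform S X (F 1 Y)) * t ^ 2 + 0 * t ^ 3
        + (2 * (bform S (F 1 X) (F 1 X) + bform S (F 1 Y) (F 1 Y))) * t ^ 4 > 0"
      using quad[of "t ^ 2"] by (simp flip: power_mult)
  qed
  \<comment> \<open>Otherwise the norm is nonpositive on the image of N, so N X and N Y are null and
    orthogonal to that image. Then N^2 kills X and Y, which is impossible.\<close>
  have "\<exists>x0. bform S (F 1 x0) (F 1 x0) > 0"
  proof (rule ccontr)
    assume "\<not> ?thesis"
    then have nonpos: "bform S (F 1 v) (F 1 v) \<le> 0" for v by (simp add: not_less)
    have null: "F 2 v = 0" if v: "bform S (F 1 v) (F 1 v) = 0" for v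
    proof (rule nondegenerate)
      fix u
      have "2 * t * bform S (F 1 v) (F 1 u) + t\<^sup>2 * bform S (F 1 u) (F 1 u) \<le> 0" for t
      proof -
        have "bform S (F 1 (v + t *s u)) (F 1 (v + t *s u))
            = 2 * t * bform S (F 1 v) (F 1 u) + t\<^sup>2 * bform S (F 1 u) (F 1 u)"
          unfolding F_add F_scale using v bform_commute[of "F 1 u" "F 1 v"]
          by (simp add: bform_simps power2_eq_square algebra_simps)
        then show ?thesis using nonpos by metis
      qed
      then have "bform S (F 1 v) (F 1 u) = 0" by (rule semidefinite_cross)
      then show "bform S (F 2 v) u = 0"
        using anti_F[of 2 v 0 u] anti_F[of 1 v 1 u] by (simp)
    qed
    have nonneg: "bform S (F 1 X) (F 1 X) + bform S (F 1 Y) (F 1 Y) \<ge> 0"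
      using sum_nonneg by simp
    have "bform S (F 1 X) (F 1 X) = 0"
      by (rule antisym[OF nonpos]) (use nonneg nonpos[of Y] in linarith)
    moreover have "bform S (F 1 Y) (F 1 Y) = 0"
      by (rule antisym[OF nonpos]) (use nonneg nonpos[of X] in linarith)
    ultimately show False
      using null even_power_witness[of 1 x] x zero by simp
  qed
  then obtain x0 where x0: "bform S (F 1 x0) (F 1 x0) > 0" by blast
  have F2x0: "F 2 x0 \<noteq> 0"
    using x0 anti_F[of 1 x0 1 x0] by (auto)
  have image: "\<exists>c. F 2 v = c *s F 2 x0" for v
  proof -
    obtain \<alpha> \<beta> \<gamma> where *: "\<alpha> \<noteq> 0 \<or> \<beta> \<noteq> 0 \<or> \<gamma> \<noteq> 0"
        "\<alpha> *s F 2 v + \<beta> *s F 2 x0 + \<gamma> *s F 1 x0 = 0"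
      using semidefinite_dependent[of "F 2 v" "F 2 x0" "F 1 x0"] x0
      by (auto simp: anti_F zero)
    have "F 1 (\<alpha> *s F 2 v + \<beta> *s F 2 x0 + \<gamma> *s F 1 x0) = 0" by (simp only: * F_zero)
    then have "\<gamma> = 0"
      unfolding F_add F_scale F_F using F2x0 by (simp add: zero)
    then have "\<alpha> \<noteq> 0" using * F2x0 by auto
    have "\<beta> *s F 2 x0 + \<alpha> *s F 2 v = 0"
      using *(2) \<open>\<gamma> = 0\<close> by (simp add: add.commute)
    then have "F 2 v = (- \<beta> / \<alpha>) *s F 2 x0"
      using \<open>\<alpha> \<noteq> 0\<close> by (rule scale_dependent)
    then show ?thesis by blast
  qed
  obtain c where c: "F 2 x = c *s F 2 x0" using image by blast
  have "c \<noteq> 0" using c x by auto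
  have y0: "bform S (F 2 x0) y = 0" using y c \<open>c \<noteq> 0\<close> by (simp add: bform_simps)
  have y0': "bform S y (F 2 x0) = 0" using y0 by (simp only: bform_commute)
  obtain d where d: "F 2 y = d *s F 2 x0" using image by blast
  \<comment> \<open>N y is null and orthogonal to N x0, since its norm and this pairing are
    multiples of (y, N^2 x0) = 0.\<close>
  obtain \<alpha> \<beta> \<gamma> where *: "\<alpha> \<noteq> 0 \<or> \<beta> \<noteq> 0 \<or> \<gamma> \<noteq> 0"
      "\<alpha> *s F 1 y + \<beta> *s F 2 x0 + \<gamma> *s F 1 x0 = 0"
    using semidefinite_dependent[of "F 1 y" "F 2 x0" "F 1 x0"] x0
    by (auto simp: anti_F zero d bform_simps y0')
  have "bform S (\<alpha> *s F 1 y + \<beta> *s F 2 x0 + \<gamma> *s F 1 x0) (F 1 x0) = 0"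
    by (simp only: * bform_zero_left)
  moreover have "bform S (F 1 y) (F 1 x0) = 0" "bform S (F 2 x0) (F 1 x0) = 0"
    using y0' by (simp_all add: anti_F zero)
  ultimately have "\<gamma> = 0" using x0 by (simp add: bform_simps)
  then have "\<alpha> \<noteq> 0" using * F2x0 by auto
  have "\<beta> *s F 2 x0 + \<alpha> *s F 1 y = 0"
    using *(2) \<open>\<gamma> = 0\<close> by (simp add: add.commute)
  then have "F 1 y = (- \<beta> / \<alpha>) *s F 2 x0"
    using \<open>\<alpha> \<noteq> 0\<close> by (rule scale_dependent)
  then have "F 1 y = (- \<beta> / (\<alpha> * c)) *s F 2 x"
    using \<open>c \<noteq> 0\<close> by (simp add: c)
  then show ?thesis unfolding F_1 by (rule exI)
qed

end

context nilpotent_antisymmetric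
begin

text \<open>N is the bivector of e and N w, and a is exp(N) w - w. This choice, rather than N w
  itself, is what later makes a integral; it differs from N w by a multiple of e and has the same
  norm.\<close>

lemma exp_eq_eichler:
  assumes F3: "\<And>x. F 3 x = 0"
    and e: "N *v e = 0" "bform S e e = 0" "\<And>y. bform S e y = 0 \<Longrightarrow> \<exists>c. N *v y = c *s e"
    and w: "bform S e w = 1"
  defines "a \<equiv> N *v w + (1 / 2) *s F 2 w"
  shows "bform S e a = 0"
    and "y + N *v y + (1 / 2) *s F 2 y = eichler S e a (bform S a a / 2) *v y"
proof -
  let ?b = "N *v w"
  have we: "bform S w e = 1" using w by (simp add: bform_commute)
  have eb: "bform S e ?b = 0" "bform S ?b e = 0"
    using anti[of e w] anti[of w e] e(1) by simp_all
  have wb: "bform S w ?b = 0" "bform S ?b w = 0"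
    using F_odd_self[of 1 w] by (simp_all add: F_1 bform_commute)
  have N: "N *v y = bform S e y *s ?b - bform S ?b y *s e" for y
  proof -
    \<comment> \<open>Splitting off the w-component leaves a vector orthogonal to e, which N maps to
      a multiple c of e; pairing with w identifies c.\<close>
    have "bform S e (y - bform S e y *s w) = 0" by (simp add: bform_simps w)
    then obtain c where c: "N *v (y - bform S e y *s w) = c *s e" using e(3) by blast
    have "c = bform S (N *v (y - bform S e y *s w)) w" by (simp add: c bform_simps w)
    also have "\<dots> = - bform S ?b y"
      by (simp add: anti bform_simps wb bform_commute[of y])
    finally show ?thesis using c
      by (simp add: matrix_vector_mult_diff_distrib matrix_vector_mult_scale diff_eq_eq)
  qed
  have F2: "F 2 y = (- (bform S ?b ?b * bform S e y)) *s e" for y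
  proof -
    have "F 2 y = N *v (bform S e y *s ?b - bform S ?b y *s e)"
      by (simp add: F_2 flip: N)
    also have "\<dots> = bform S e y *s (N *v ?b)"
      by (simp add: matrix_vector_mult_diff_distrib matrix_vector_mult_scale e(1))
    also have "N *v ?b = (- bform S ?b ?b) *s e"
      by (subst N) (simp add: eb vec_eq_iff)
    finally show ?thesis by (simp add: vec_eq_iff mult_ac)
  qed
  have a: "a = ?b - (bform S ?b ?b / 2) *s e"
    by (simp add: a_def F2 w vec_eq_iff)
  show "bform S e a = 0" by (simp add: a bform_simps eb e(2))
  have aa: "bform S a a = bform S ?b ?b" by (simp add: a bform_simps eb e(2))
  show "y + N *v y + (1 / 2) *s F 2 y = eichler S e a (bform S a a / 2) *v y"
    unfolding eichler_mult aa F2 N[of y]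
    by (simp add: a bform_simps vec_eq_iff algebra_simps)
qed

end

section \<open>Complexification\<close>

definition cvec :: "real^'n \<Rightarrow> real^'n \<Rightarrow> complex^'n" where
  "cvec X Y = (\<chi> i. Complex (X $ i) (Y $ i))"

lemma cvec_eq: "cvec X Y = map_vector of_real X + \<i> *s map_vector of_real Y"
  by (simp add: cvec_def vec_eq_iff complex_eq_iff)

lemma cnj_cvec: "map_vector cnj (cvec X Y) = map_vector of_real X - \<i> *s map_vector of_real Y"
  by (simp add: cvec_def vec_eq_iff complex_eq_iff)

lemma cvec_cases: obtains X Y where "Z = cvec X Y"
proof
  show "Z = cvec (map_vector Re Z) (map_vector Im Z)"
    by (simp add: cvec_def vec_eq_iff)
qed

lemma cvec_add: "cvec X Y + cvec X' Y' = cvec (X + X') (Y + Y')"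
  by (simp add: cvec_def vec_eq_iff complex_eq_iff)

lemma cvec_scale: "of_real c *s cvec X Y = cvec (c *s X) (c *s Y)"
  by (simp add: cvec_def vec_eq_iff complex_eq_iff)

lemma cvec_zero [simp]: "cvec 0 0 = 0"
  by (simp add: cvec_def vec_eq_iff complex_eq_iff)

lemma scaled_matrix_mult_cvec:
  "map_matrix (\<lambda>x. \<i> * of_real y * of_real x) N *v cvec X Y =
     cvec (- (y *s (N *v Y))) (y *s (N *v X))"
  by (simp add: cvec_def vec_eq_iff complex_eq_iff matrix_vector_mult_def sum_distrib_left
      mult.assoc flip: sum_negf)

context symmetric_form
begin

lemma bform_cvec_self:
  "bform S (cvec X Y) (cvec X Y) = Complex (bform S X X - bform S Y Y) (2 * bform S X Y)"
  by (simp add: cvec_eq bform_simps bform_of_real bform_commute[of "map_vector of_real Y" "map_vector of_real X"]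
      bform_commute[of Y X] complex_eq_iff)

lemma Re_bform_cvec_cnj:
  "Re (bform S (cvec X Y) (map_vector cnj (cvec X Y))) = bform S X X + bform S Y Y"
  by (simp add: cvec_eq cnj_cvec[unfolded cvec_eq] bform_simps bform_of_real)

text \<open>The conditions are imposed on a representative of the projective point. Rescaling by c
  multiplies them by c^2 and |c|^2, so they hold on the whole cone.\<close>

lemma affine_cone_cvec:
  assumes D: "is_domain S \<D>" and Z: "cvec X Y \<in> affine_cone \<D>"
  shows "bform S X X = bform S Y Y" "bform S X Y = 0" "bform S X X + bform S Y Y > 0"
proof -
  let ?Z = "cvec X Y"
  have "\<D> \<subseteq> period_set S"
    using D connected_components_of_subset[of \<D>] unfolding is_domain_def by fastforce
  then have "proj_point ?Z \<in> period_set S" using Z by (auto simp: affine_cone_def)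
  then obtain Z' where Z': "bform S Z' Z' = 0" "Re (bform S Z' (map_vector cnj Z')) > 0"
      "proj_point ?Z = proj_point Z'"
    by (auto simp: period_set_def)
  have "?Z \<in> proj_point ?Z" unfolding proj_point_def by (intro CollectI exI[of _ 1]) simp
  then obtain c where c: "c \<noteq> 0" "?Z = c *s Z'" using Z'(3) by (auto simp: proj_point_def)
  have "bform S ?Z ?Z = 0" using Z'(1) by (simp add: c bform_simps)
  then show "bform S X X = bform S Y Y" "bform S X Y = 0"
    by (simp_all add: bform_cvec_self complex_eq_iff)
  have "map_vector cnj ?Z = cnj c *s map_vector cnj Z'"
    by (simp add: c vec_eq_iff)
  then have "bform S ?Z (map_vector cnj ?Z) = (c * cnj c) * bform S Z' (map_vector cnj Z')"
    by (simp add: c(2) bform_simps mult_ac)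
  also have "c * cnj c = of_real ((cmod c)\<^sup>2)" by (rule complex_norm_square[symmetric])
  finally have "Re (bform S ?Z (map_vector cnj ?Z)) = (cmod c)\<^sup>2 * Re (bform S Z' (map_vector cnj Z'))"
    by simp
  then show "bform S X X + bform S Y Y > 0"
    using Z'(2) c(1) by (simp add: Re_bform_cvec_cnj)
qed

end

context nilpotent_antisymmetric
begin

lemma exp_scaled_cvec:
  "exp_scaled (\<i> * of_real y) N *v cvec X Y =
     cvec (X - y *s F 1 Y - (y ^ 2 / 2) *s F 2 X + (y ^ 3 / 6) *s F 3 Y + (y ^ 4 / 24) *s F 4 X)
       (Y + y *s F 1 X - (y ^ 2 / 2) *s F 2 Y - (y ^ 3 / 6) *s F 3 X + (y ^ 4 / 24) *s F 4 Y)"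
proof -
  let ?A = "map_matrix (\<lambda>x. \<i> * of_real y * of_real x) N"
  have step: "?A *v cvec P Q = cvec (- (y *s F 1 Q)) (y *s F 1 P)" for P Q
    by (simp add: scaled_matrix_mult_cvec F_1)
  have minus: "F k (- x) = - F k x" for k x
    using F_scale[of k "-1" x] by simp
  have Suc: "((*v) ?A ^^ (1 + k)) W = ?A *v ((*v) ?A ^^ k) W" for k W
    by (simp add: One_nat_def)
  have pow1: "((*v) ?A ^^ 1) (cvec P Q) = cvec (- (y *s F 1 Q)) (y *s F 1 P)" for P Q
    using Suc[of 0] by (simp add: step)
  have pow2: "((*v) ?A ^^ 2) (cvec P Q) = cvec (- (y ^ 2 *s F 2 P)) (- (y ^ 2 *s F 2 Q))" for P Q
    using Suc[of 1 "cvec P Q"] by (simp add: pow1 step F_scale F_F minus power2_eq_square)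
  have pow3: "((*v) ?A ^^ 3) (cvec P Q) = cvec (y ^ 3 *s F 3 Q) (- (y ^ 3 *s F 3 P))" for P Q
    using Suc[of 2 "cvec P Q"] by (simp add: pow2 step F_scale F_F minus power_numeral_reduce)
  have pow4: "((*v) ?A ^^ 4) (cvec P Q) = cvec (y ^ 4 *s F 4 P) (y ^ 4 *s F 4 Q)" for P Q
    using Suc[of 3 "cvec P Q"] by (simp add: pow3 step F_scale F_F minus power_numeral_reduce)
  have pow5: "((*v) ?A ^^ 5) (cvec P Q) = 0" for P Q
    using Suc[of 4 "cvec P Q"] by (simp add: pow4 step F_scale F_F F_5)
  note pow = pow1 pow2 pow3 pow4
  have "((*v) ?A ^^ 5) W = 0" for W
    by (cases W rule: cvec_cases) (simp add: pow5)
  then have "mat_exp ?A *v cvec X Y = (\<Sum>k<5. (1 / fact k) *s ((*v) ?A ^^ k) (cvec X Y))"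
    by (rule mat_exp_nilpotent)
  \<comment> \<open>Real coefficients, so that \<open>cvec_scale\<close> can act on real and
    imaginary parts.\<close>
  also have "\<dots> = (\<Sum>k<5. of_real (1 / fact k) *s ((*v) ?A ^^ k) (cvec X Y))"
    by simp
  also have "{..<5::nat} = {0, 1, 2, 3, 4}" by auto
  also have "(\<Sum>k\<in>{0, 1, 2, 3, 4}. of_real (1 / fact k) *s ((*v) ?A ^^ k) (cvec X Y)) =
     cvec (X - y *s F 1 Y - (y ^ 2 / 2) *s F 2 X + (y ^ 3 / 6) *s F 3 Y + (y ^ 4 / 24) *s F 4 X)
       (Y + y *s F 1 X - (y ^ 2 / 2) *s F 2 Y - (y ^ 3 / 6) *s F 3 X + (y ^ 4 / 24) *s F 4 Y)"
    by (simp del: of_real_divide add: pow cvec_scale cvec_add fact_numeral)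
      (simp add: cvec_def vec_eq_iff field_simps)
  finally show ?thesis by (simp add: exp_scaled_def)
qed

end

section \<open>The dual lattice\<close>

context signature_form
begin

lemma det_nonzero: "det S \<noteq> 0"
proof -
  have "x = 0" if "map_matrix real_of_int S *v x = 0" for x
  proof (rule nondegenerate)
    fix y
    have "bform S y x = (\<Sum>i\<in>UNIV. y $ i * (map_matrix real_of_int S *v x) $ i)"
      by (simp add: bform_def matrix_vector_mult_def sum_distrib_left mult_ac)
    then show "bform S x y = 0" using that by (simp add: bform_commute)
  qed
  then have "invertible (map_matrix real_of_int S)"
    by (metis invertible_left_inverse matrix_left_invertible_ker)
  then show ?thesis by (simp add: invertible_det_nz det_of_int)
qed

text \<open>Every integral functional on L is pairing with a dual vector, obtained by inverting the
  Gram matrix over the rationals.\<close>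

lemma dual_vector:
  fixes c :: "int^'n"
  obtains w where "w \<in> dual_lattice S" "\<forall>x. bform S x w = (\<Sum>i\<in>UNIV. x $ i * of_int (c $ i))"
proof -
  have "invertible (map_matrix rat_of_int S)"
    using det_nonzero by (simp add: invertible_det_nz det_of_int)
  then obtain A where A: "map_matrix rat_of_int S ** A = mat 1" unfolding invertible_def by blast
  define w where "w = A *v map_vector of_int c"
  have Sw: "map_matrix rat_of_int S *v w = map_vector of_int c"
    by (simp add: w_def matrix_vector_mul_assoc A)
  have w: "bform S x w = (\<Sum>i\<in>UNIV. x $ i * of_int (c $ i))" for x
  proof -
    have "bform S x w = (\<Sum>i\<in>UNIV. x $ i * (map_matrix rat_of_int S *v w) $ i)"
      by (simp add: bform_def matrix_vector_mult_def sum_distrib_left mult_ac)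
    then show ?thesis by (simp add: Sw)
  qed
  have "w \<in> dual_lattice S"
    unfolding dual_lattice_def
    by (auto simp: bform_commute[of w] w intro!: Ints_sum Ints_mult)
  then show thesis using that[of w] w by simp
qed

end

section \<open>Boundary elements are transvections\<close>

lemma O_tilde_dual:
  assumes "g \<in> O_tilde S" "w \<in> dual_lattice S"
  obtains l :: "int^'n" where "map_matrix of_int g *v w = w + map_vector of_int l"
proof -
  let ?A = "{w + map_vector of_int l | l :: int^'n. True}"
  have "?A \<in> discriminant_group S" using assms(2) by (auto simp: discriminant_group_def)
  then have image: "(*v) (map_matrix of_int g) ` ?A = ?A" using assms(1) by (simp add: O_tilde_def)
  have "w = w + map_vector of_int (0 :: int^'n)" by (simp add: vec_eq_iff)
  then have "w \<in> ?A" by blast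
  then have "map_matrix of_int g *v w \<in> ?A" using image by blast
  then show thesis using that by blast
qed

context positive_nilpotent
begin

text \<open>An integral vector on the isotropic line of the real matrix N is found in the image of r
  - 1 when N^2 = 0, and of (r - 1)^2 otherwise.\<close>

lemma nilpotent_image_primitive:
  assumes r: "\<And>y. map_matrix of_int r *v y = y + N *v y + (1 / 2) *s F 2 y" and "r \<noteq> mat 1"
  obtains u :: "int^'n" where "u \<noteq> 0" "N *v map_vector of_int u = 0"
    "bform S u u = 0"
    "\<And>y. bform S (map_vector of_int u) y = 0 \<Longrightarrow> \<exists>c. N *v y = c *s map_vector of_int u"
proof (cases "\<forall>x. F 2 x = 0")
  case True
  let ?A = "r - mat 1"
  have A: "map_matrix of_int ?A *v y = N *v y" for y :: "real^'n"
  proof -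
    have "map_matrix real_of_int ?A = map_matrix of_int r - mat 1"
      by (simp add: vec_eq_iff mat_def)
    then show ?thesis using True by (simp add: r matrix_vector_mult_diff_rdistrib)
  qed
  have "?A \<noteq> 0" using assms(2) by simp
  then obtain x where x: "?A *v x \<noteq> 0" by (auto simp: matrix_eq)
  let ?u = "?A *v x"
  have u: "map_vector real_of_int ?u = N *v map_vector of_int x"
    by (simp add: A flip: of_int_matrix_vector_mult)
  have nz: "N *v map_vector of_int x \<noteq> 0"
    using x by (auto simp: vec_eq_iff simp flip: u)
  show thesis
  proof (rule that[of ?u])
    show "N *v map_vector of_int ?u = 0" unfolding u using True by (simp add: F_2)
    have "bform S (map_vector real_of_int ?u) (map_vector of_int ?u) = 0"
      unfolding u using anti_F[of 1 "map_vector of_int x" 1 "map_vector of_int x"] True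
      by (simp add: F_1)
    then show "bform S ?u ?u = 0" by (simp add: bform_of_int)
    show "\<exists>c. N *v y = c *s map_vector of_int ?u" if "bform S (map_vector of_int ?u) y = 0" for y
      using rank_one_on_complement_of_square_zero[OF _ nz, of y] True that unfolding u by blast
  qed (rule x)
next
  case False
  let ?A = "(r - mat 1) ** (r - mat 1)"
  have zero: "F k x = 0" if "k \<ge> 3" for k x using F_eq_0_mono[OF F_3 that] .
  have A: "map_matrix of_int ?A *v y = F 2 y" for y :: "real^'n"
  proof -
    have "map_matrix real_of_int (r - mat 1) = map_matrix of_int r - mat 1"
      by (simp add: vec_eq_iff mat_def)
    then have 1: "map_matrix of_int (r - mat 1) *v z = F 1 z + (1 / 2) *s F 2 z" for z :: "real^'n"
      by (simp add: r matrix_vector_mult_diff_rdistrib F_1)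
    have "map_matrix of_int ?A *v y = map_matrix of_int (r - mat 1) *v (map_matrix of_int (r - mat 1) *v y)"
      by (simp only: of_int_matrix_mult matrix_vector_mul_assoc)
    \<comment> \<open>The square of N + N^2/2 is N^2, because N^3 = 0.\<close>
    also have "\<dots> = F 2 y"
      unfolding 1 F_add F_scale F_F by (simp add: zero)
    finally show ?thesis .
  qed
  have "?A \<noteq> 0"
  proof
    assume "?A = 0"
    then have "map_matrix real_of_int ?A = 0" by (simp add: vec_eq_iff)
    then have "F 2 y = 0" for y using A[of y] by simp
    then show False using False by blast
  qed
  then obtain x where x: "?A *v x \<noteq> 0" by (auto simp: matrix_eq)
  let ?u = "?A *v x"
  have u: "map_vector real_of_int ?u = F 2 (map_vector of_int x)"
    using A[of "map_vector of_int x"] by (simp only: of_int_matrix_vector_mult)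
  have nz: "F 2 (map_vector of_int x) \<noteq> 0"
    using x by (auto simp: vec_eq_iff simp flip: u)
  show thesis
  proof (rule that[of ?u])
    show "N *v map_vector of_int ?u = 0"
      unfolding u using F_F[of 1 2 "map_vector of_int x"] by (simp add: F_1 F_3)
    have "bform S (map_vector real_of_int ?u) (map_vector of_int ?u) = 0"
      unfolding u anti_F by (simp add: zero)
    then show "bform S ?u ?u = 0" by (simp add: bform_of_int)
    show "\<exists>c. N *v y = c *s map_vector of_int ?u" if "bform S (map_vector of_int ?u) y = 0" for y
      using rank_one_on_complement_of_square[OF nz, of y] that unfolding u by blast
  qed (rule x)
qed

lemma boundary_element_eichler:
  assumes r: "\<And>y. map_matrix of_int r *v y = y + N *v y + (1 / 2) *s F 2 y"
    and r1: "r \<noteq> mat 1" and rO: "r \<in> O_tilde S"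
    and even: "\<And>x :: int^'n. even (bform S x x)"
  obtains e a :: "int^'n" where "bform S e e = 0" "bform S e a = 0"
    "r = eichler S e a (bform S a a div 2)"
proof -
  obtain u :: "int^'n" where u: "u \<noteq> 0" "N *v map_vector of_int u = 0" "bform S u u = 0"
    "\<And>y. bform S (map_vector of_int u) y = 0 \<Longrightarrow> \<exists>c. N *v y = c *s map_vector of_int u"
    using nilpotent_image_primitive[OF r r1] by metis
  have "\<exists>i\<in>UNIV. u $ i \<noteq> 0" using u(1) by (auto simp: vec_eq_iff)
  \<comment> \<open>Dividing u by its content gives a primitive e on the same line. The Bezout
    coefficients c define a functional with value 1 on e, represented below by a dual vector
    w.\<close>
  then obtain g e' c where gec: "g \<noteq> 0" "\<forall>i\<in>UNIV. u $ i = g * e' i" "(\<Sum>i\<in>UNIV. c i * e' i) = 1"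
    using primitive_part[of UNIV "($) u"] by auto
  define e where "e = (\<chi> i. e' i)"
  have ue: "u = g *s e" using gec(2) by (simp add: e_def vec_eq_iff)
  have ue_real: "map_vector real_of_int u = of_int g *s map_vector of_int e"
    by (simp add: ue map_vector_of_int_scale)
  let ?e = "map_vector real_of_int e"
  have "of_int g *s (N *v ?e) = 0"
    using u(2) unfolding ue_real by (simp add: matrix_vector_mult_scale)
  then have e: "N *v ?e = 0" "bform S e e = 0" "bform S ?e ?e = 0"
    using u(3) gec(1) by (simp_all add: ue bform_simps bform_of_int)
  have e_compl: "\<exists>c. N *v y = c *s ?e" if "bform S ?e y = 0" for y
  proof -
    have "bform S (map_vector of_int u) y = 0" using that by (simp add: ue_real bform_simps)
    then obtain d where "N *v y = d *s map_vector of_int u" using u(4) by blast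
    then show ?thesis by (auto simp: ue_real)
  qed
  obtain w where w: "w \<in> dual_lattice S" "\<forall>x. bform S x w = (\<Sum>i\<in>UNIV. x $ i * of_int ((\<chi> i. c i) $ i))"
    by (rule dual_vector)
  let ?w = "map_vector real_of_rat w"
  have of_rat_int: "map_vector real_of_rat (map_vector of_int x) = map_vector of_int x" for x :: "int^'n"
    by (simp add: vec_eq_iff)
  have "bform S (map_vector of_int e) w = of_int (\<Sum>i\<in>UNIV. c i * e' i)"
    by (simp add: w(2) e_def mult.commute)
  then have ew: "bform S ?e ?w = 1"
    using bform_of_rat[of S "map_vector of_int e" w, where 'a = real] gec(3) by (simp add: of_rat_int)
  \<comment> \<open>Here the discriminant kernel enters: r maps w to the same coset of L, so r w - w
    is integral.\<close>
  obtain a :: "int^'n" where a: "map_matrix of_int r *v w = w + map_vector of_int a"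
    using O_tilde_dual[OF rO w(1)] by blast
  have "map_matrix real_of_int r *v ?w = map_vector of_rat (w + map_vector of_int a)"
    by (simp only: of_rat_matrix_vector_mult a)
  also have "\<dots> = ?w + map_vector of_int a" by (simp add: vec_eq_iff of_rat_add)
  finally have a_eq: "N *v ?w + (1 / 2) *s F 2 ?w = map_vector of_int a"
    using r[of ?w] by (simp add: add.assoc)
  let ?a = "map_vector real_of_int a"
  have ea: "bform S ?e ?a = 0"
    using exp_eq_eichler(1)[OF F_3 e(1,3) e_compl ew] unfolding a_eq by simp
  have "bform S ?a ?a / 2 = of_int (bform S a a div 2)"
    using even[of a] by (simp add: bform_of_int real_of_int_div)
  then have "map_matrix real_of_int r = eichler S ?e ?a (of_int (bform S a a div 2))"
    using exp_eq_eichler(2)[OF F_3 e(1,3) e_compl ew] r unfolding a_eq by (simp add: matrix_eq)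
  then have "r = eichler S e a (bform S a a div 2)"
    by (simp add: of_int_matrix_eq_iff flip: eichler_of_int)
  moreover have "bform S e a = 0" using ea by (simp add: bform_of_int)
  ultimately show thesis using that e(2) by blast
qed

end

section \<open>Integral exponents and existence of the order\<close>

lemma exponents_eq_Ints:
  assumes "1 = exp (2 * of_real pi * \<i> * of_real a)"
  shows "exponents a = \<int>"
proof -
  obtain j :: int where "2 * pi * a = of_int (2 * j) * pi"
    using assms[symmetric] by (auto simp: exp_eq_1)
  then have a: "a = of_int j" by simp
  have "exponents a = range (\<lambda>i. of_int (j + i))"
    by (auto simp: exponents_def a)
  also have "\<dots> = \<int>"
  proof
    show "\<int> \<subseteq> range (\<lambda>i. real_of_int (j + i))"
    proof
      fix x :: real assume "x \<in> \<int>"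
      then obtain i where "x = of_int i" by (auto elim: Ints_cases)
      then have "x = of_int (j + (i - j))" by simp
      then show "x \<in> range (\<lambda>i. real_of_int (j + i))" by blast
    qed
  qed auto
  finally show ?thesis .
qed

text \<open>At z = 0 the toroidal expansion exhibits the value at Z as the sum of its coefficients,
  so a nonzero value forces a nonzero coefficient.\<close>

lemma exp_scaled_0:
  fixes N :: "real^'n^'n"
  shows "exp_scaled 0 N *v Z = Z"
proof -
  have "map_matrix (\<lambda>x. 0 * of_real x) N = (0 :: complex^'n^'n)"
    by (simp add: vec_eq_iff)
  moreover have "mat_exp (0 :: complex^'n^'n) *v Z = (\<Sum>k<1. (1 / fact k) *s ((*v) 0 ^^ k) Z)"
    by (rule mat_exp_nilpotent) (simp add: matrix_vector_mult_def vec_eq_iff)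
  ultimately show ?thesis by (simp add: exp_scaled_def)
qed

lemma boundary_divisor_transvection:
  fixes S :: "int^'n^'n"
  assumes S: "even_lattice S" "has_signature S 2 n"
    and D: "is_domain S \<D>" and nonempty: "affine_cone \<D> \<noteq> {}"
    and \<Gamma>: "\<Gamma> \<subseteq> O_tilde_plus S" and bd: "boundary_divisor S \<Gamma> \<D> E r N"
  obtains e a :: "int^'n" where "bform S e e = 0" "bform S e a = 0"
    "r = eichler S e a (bform S a a div 2)"
proof -
  interpret signature_form S n
    using S by unfold_locales (auto simp: even_lattice_def)
  have r: "r \<in> O_tilde_plus S" "r \<noteq> mat 1" "nilpotent_mat N" "map_matrix of_int r = mat_exp N"
    and cone: "\<And>z Z. Im z \<ge> 0 \<Longrightarrow> Z \<in> affine_cone \<D> \<Longrightarrow> exp_scaled z N *v Z \<in> affine_cone \<D>"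
    using bd \<Gamma> by (auto simp: boundary_divisor_def cusp_centre_int_def)
  have orth: "bform S (mat_exp N *v x) (mat_exp N *v y) = bform S x y" for x y
    using r(1) by (simp add: O_tilde_plus_def O_plus_real_def orthogonal_group_def flip: r(4))
  interpret nilpotent_antisymmetric S n N
    by unfold_locales (use antisymmetric_log[OF r(3) refl orth] r(3) in auto)
  obtain Z where Z: "Z \<in> affine_cone \<D>" using nonempty by blast
  obtain X Y where XY: "Z = cvec X Y" by (rule cvec_cases)
  note Z' = affine_cone_cvec[OF D Z[unfolded XY]]
  interpret positive_nilpotent S n N X Y
  proof
    fix y :: real assume "y \<ge> 0"
    \<comment> \<open>Invariance of the cone at z = iy gives the positivity of P + iQ.\<close>
    then have "exp_scaled (\<i> * of_real y) N *v cvec X Y \<in> affine_cone \<D>"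
      using Z by (intro cone) (simp_all add: XY)
    then show "let P = X - y *s F 1 Y - (y\<^sup>2 / 2) *s F 2 X + (y ^ 3 / 6) *s F 3 Y + (y ^ 4 / 24) *s F 4 X;
           Q = Y + y *s F 1 X - (y\<^sup>2 / 2) *s F 2 Y - (y ^ 3 / 6) *s F 3 X + (y ^ 4 / 24) *s F 4 Y
       in 0 < bform S P P + bform S Q Q"
      unfolding exp_scaled_cvec Let_def by (rule affine_cone_cvec(3)[OF D])
  qed (use Z' in auto)
  have "map_matrix of_int r *v y = y + N *v y + (1 / 2) *s F 2 y" for y
  proof -
    have "mat_exp N *v y = (\<Sum>k<3. (1 / fact k) *s F k y)"
      unfolding F_def by (rule mat_exp_nilpotent) (use F_3 in \<open>simp add: F_def\<close>)
    also have "{..<3::nat} = {0, 1, 2}" by auto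
    finally show ?thesis by (simp add: r(4) F_1 add.assoc)
  qed
  moreover have "r \<in> O_tilde S" using r(1) by (simp add: O_tilde_plus_def)
  ultimately show thesis
    using boundary_element_eichler[of r] r(2) S(1) that by (auto simp: even_lattice_def)
qed

theorem corollary2p2:
  fixes S :: "int^'n^'n" and n :: nat
    and \<Gamma> :: "(int^'n^'n) set"
    and \<D> :: "(complex^'n) set set"
    and k :: int and \<xi> :: "int^'n^'n \<Rightarrow> complex" and \<psi> :: "complex^'n \<Rightarrow> complex"
    and E :: "(rat^'n) set" and r :: "int^'n^'n" and N :: "real^'n^'n"
  assumes "even_lattice S"
    and "has_signature S 2 n"
    and "contains_two_hyperbolic_planes S"
    and "rank_mod 2 S \<ge> 6"
    and "rank_mod 3 S \<ge> 5"
    and "\<Gamma> = O_tilde_plus S \<or> \<Gamma> = SO_tilde_plus S"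
    and "is_domain S \<D>"
    and "cusp_form S \<Gamma> \<D> k \<xi> \<psi>"
    and "\<exists>Z\<in>affine_cone \<D>. \<psi> Z \<noteq> 0"
    and "boundary_divisor S \<Gamma> \<D> E r N"
  shows "(\<exists>m. vanishing_order \<D> \<xi> \<psi> r N m) \<and>
         (\<forall>m. vanishing_order \<D> \<xi> \<psi> r N m \<longrightarrow> m \<in> \<int> \<and> m \<ge> 1)"
proof -
  have \<Gamma>: "\<Gamma> \<subseteq> O_tilde_plus S" "SO_tilde_plus S \<subseteq> \<Gamma>"
    using assms(6) by (auto simp: SO_tilde_plus_def)
  have modular: "modular_form S \<Gamma> \<D> k \<xi> \<psi>"
    and cusp: "\<And>m. vanishing_order \<D> \<xi> \<psi> r N m \<Longrightarrow> m > 0"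
    using assms(8,10) by (auto simp: cusp_form_def)
  have hom: "\<xi> \<in> hom (mat_group \<Gamma>) \<lparr>carrier = - {0}, mult = (*), one = 1\<rparr>"
    using modular by (simp add: modular_form_def finite_order_character_def)
  interpret form_character S \<xi>
  proof
    show "bform S x y = bform S y x" "even (bform S x x)" for x y :: "int^'n"
      using assms(1) by (auto simp: even_lattice_def)
    show "\<exists>e f e' f'. plane_pair S e f e' f'"
      using assms(3) unfolding contains_two_hyperbolic_planes_def plane_pair_def
      by (elim exE conjE) (intro exI conjI)
    show "\<xi> (g ** h) = \<xi> g * \<xi> h" if "g \<in> SO_tilde_plus S" "h \<in> SO_tilde_plus S" for g h
      using hom_mult[OF hom, of g h] that \<Gamma>(2) by (auto simp: mat_group_def)
    show "\<xi> g \<noteq> 0" if "g \<in> SO_tilde_plus S" for g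
      using hom_in_carrier[OF hom, of g] that \<Gamma>(2) by (auto simp: mat_group_def)
  qed (use assms(4,5) in auto)
  have "affine_cone \<D> \<noteq> {}" using assms(9) by blast
  then obtain e a :: "int^'n" where "bform S e e = 0" "bform S e a = 0"
      "r = eichler S e a (bform S a a div 2)"
    by (rule boundary_divisor_transvection[OF assms(1,2,7) _ \<Gamma>(1) assms(10)])
  then have \<xi>_r: "\<xi> r = 1"
    using character_transvection[of e a] by (simp add: transvection_def)
  have Ints: "exponents b = \<int>" if "toroidal_expansion \<D> \<xi> \<psi> r N b c" for b c
    using that \<xi>_r by (intro exponents_eq_Ints) (simp add: toroidal_expansion_def)
  have "m \<in> \<int> \<and> m \<ge> 1" if m: "vanishing_order \<D> \<xi> \<psi> r N m" for m
  proof -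
    have "m \<in> \<int>" using m Ints unfolding vanishing_order_def by blast
    moreover from this obtain j where "m = of_int j" by (auto elim: Ints_cases)
    ultimately show ?thesis using cusp[OF m] by simp
  qed
  moreover have "\<exists>m. vanishing_order \<D> \<xi> \<psi> r N m"
  proof -
    obtain b c where c: "toroidal_expansion \<D> \<xi> \<psi> r N b c"
        "\<forall>m\<in>exponents b. m < 0 \<longrightarrow> (\<forall>Z\<in>affine_cone \<D>. c m Z = 0)"
      using modular assms(10) unfolding modular_form_def by blast
    obtain Z where Z: "Z \<in> affine_cone \<D>" "\<psi> Z \<noteq> 0" using assms(9) by blast
    have "((\<lambda>m. c m Z * exp (2 * of_real pi * \<i> * of_real m * z)) has_sum
        \<psi> (exp_scaled z N *v Z)) (exponents b)" if "Im z \<ge> 0" for z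
      using c(1) Z(1) that unfolding toroidal_expansion_def by blast
    from this[of 0] have sum: "((\<lambda>m. c m Z) has_sum \<psi> Z) \<int>"
      by (simp add: exp_scaled_0 Ints[OF c(1)])
    have "\<exists>m\<in>\<int>. c m Z \<noteq> 0"
    proof (rule ccontr)
      assume "\<not> ?thesis"
      then have "((\<lambda>m. c m Z) has_sum 0) \<int>" by (intro has_sum_0) auto
      then show False using has_sum_unique[OF sum] Z(2) by blast
    qed
    then obtain j :: int where j: "c (of_int j) Z \<noteq> 0" by (auto elim!: Ints_cases)
    have nonneg: "i \<ge> 0" if "Z \<in> affine_cone \<D>" "c (of_int i) Z \<noteq> 0" for i Z
      using c(2) that unfolding Ints[OF c(1)] by (metis Ints_of_int not_le of_int_less_0_iff)
    \<comment> \<open>Exponents are integers and nonzero coefficients occur only at nonnegative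
      ones, so a least natural exponent over all points of the cone exists.\<close>
    define l where "l = (LEAST l::nat. \<exists>Z\<in>affine_cone \<D>. c (of_int (int l)) Z \<noteq> 0)"
    have "\<exists>Z\<in>affine_cone \<D>. c (of_int (int (nat j))) Z \<noteq> 0"
      using j nonneg[OF Z(1) j] Z(1) by auto
    then have l: "\<exists>Z\<in>affine_cone \<D>. c (of_int (int l)) Z \<noteq> 0"
      unfolding l_def by (rule LeastI)
    have least: "c m Z = 0" if m: "m \<in> \<int>" "m < of_int (int l)" and Z: "Z \<in> affine_cone \<D>" for m Z
    proof (rule ccontr)
      assume *: "c m Z \<noteq> 0"
      obtain i where i: "m = of_int i" using m(1) by (auto elim: Ints_cases)
      then have "i \<ge> 0" using nonneg[OF Z] * by simp
      then have "\<exists>Z\<in>affine_cone \<D>. c (of_int (int (nat i))) Z \<noteq> 0" "nat i < l"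
        using * i Z m(2) by auto
      then show False unfolding l_def using not_less_Least by blast
    qed
    show ?thesis
      unfolding vanishing_order_def
    proof (intro exI conjI)
      show "toroidal_expansion \<D> \<xi> \<psi> r N b c" by (rule c(1))
      show "of_int (int l) \<in> exponents b" unfolding Ints[OF c(1)] by simp
      show "\<forall>m'\<in>exponents b. m' < of_int (int l) \<longrightarrow> (\<forall>Z\<in>affine_cone \<D>. c m' Z = 0)"
        unfolding Ints[OF c(1)] using least by simp
    qed (rule l)
  qed
  ultimately show ?thesis by blast
qed

end
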